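(* Fix $\Delta \ge 3$. Let $(G_n)$ be a sequence of graphs, $G_n$ of maximum degree at most $\Delta$ on $n$ vertices, and let $(\lambda_n)$ be positive reals with $n\lambda_n\to\infty$ and $\lambda_n \le \frac{1}{100 \Delta^2}$. Let $Y_n$ be the size of a random independent set drawn from the hard-core model on $G_n$ at fugacity $\lambda_n$, with mean $\mu_n$ and variance $\sigma_n^2$. Then $Y_n$ satisfies a local central limit theorem as $n\to\infty$, i.e. \[\sup_{k \in \mathbb{Z}} \left| \mathbb{P}[Y_n=k] - \frac{1}{\sqrt{2 \pi} \sigma_n} e^{ -(k-\mu_n)^2/(2 \sigma_n^2)}\right| = o\left( \sigma_n^{-1} \right).\]
   Context: The hard-core model on a graph $G$ at fugacity $\lambda>0$ is the distribution on independent sets $I$ of $G$ with $\mathbb{P}(I) = \lambda^{|I|}/Z_G(\lambda)$, $Z_G(\lambda)=\sum_I\lambda^{|I|}$. *)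

theory Defs
  imports "HOL-Probability.Probability" "Graph_Theory.Pair_Digraph"
begin

text \<open>
  Finite simple graphs are the symmetric, loop-free, finite digraphs of \<^locale>\<open>pair_graph\<close>: an
  undirected edge \<open>{u, v}\<close> is represented by the two arcs \<open>(u, v)\<close> and \<open>(v, u)\<close>, so the degree
  of a vertex is its \<^const>\<open>out_degree\<close>.
\<close>

definition independent_set :: "'a pair_pre_digraph \<Rightarrow> 'a set \<Rightarrow> bool" where
  "independent_set G I \<longleftrightarrow> I \<subseteq> pverts G \<and> (\<forall>u\<in>I. \<forall>v\<in>I. (u, v) \<notin> parcs G)"

definition partition_function :: "'a pair_pre_digraph \<Rightarrow> real \<Rightarrow> real" where
  "partition_function G l = (\<Sum>I | independent_set G I. l ^ card I)"

definition hard_core :: "'a pair_pre_digraph \<Rightarrow> real \<Rightarrow> 'a set pmf" where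
  "hard_core G l =
     embed_pmf (\<lambda>I. if independent_set G I then l ^ card I / partition_function G l else 0)"

lemma finite_independent_sets:
  assumes "finite (pverts G)"
  shows "finite {I. independent_set G I}"
  by (rule finite_subset[of _ "Pow (pverts G)"]) (auto simp: independent_set_def assms)

lemma partition_function_pos:
  assumes "finite (pverts G)" and "l > 0"
  shows "partition_function G l > 0"
  unfolding partition_function_def
  using assms by (intro sum_pos finite_independent_sets) (auto simp: independent_set_def)

text \<open>The weights are a probability mass function, so \<^const>\<open>embed_pmf\<close> is not used outside its domain.\<close>

lemma pmf_hard_core:
  assumes "finite (pverts G)" and "l > 0"
  shows "pmf (hard_core G l) I =
    (if independent_set G I then l ^ card I / partition_function G l else 0)"
  unfolding hard_core_def
proof (rule pmf_embed_pmf)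
  let ?f = "\<lambda>I. if independent_set G I then l ^ card I / partition_function G l else 0"
  note Z = partition_function_pos[OF assms]
  show nn: "0 \<le> ?f I" for I
    using Z assms by simp
  have "(\<integral>\<^sup>+ I. ennreal (?f I) \<partial>count_space UNIV)
      = (\<Sum>I | independent_set G I. ennreal (?f I))"
    by (rule nn_integral_count_space'[OF finite_independent_sets[OF assms(1)]]) auto
  also have "\<dots> = ennreal (\<Sum>I | independent_set G I. ?f I)"
    by (rule sum_ennreal) (rule nn)
  also have "(\<Sum>I | independent_set G I. ?f I)
      = (\<Sum>I | independent_set G I. l ^ card I / partition_function G l)"
    by (rule sum.cong) auto
  also have "\<dots> = 1"
    using Z by (simp add: sum_divide_distrib[symmetric] partition_function_def)
  finally show "(\<integral>\<^sup>+ I. ennreal (?f I) \<partial>count_space UNIV) = 1"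
    by simp
qed

text \<open>The real-valued supremum in the local limit theorem is taken over a bounded set.\<close>

lemma bdd_above_lclt_error:
  fixes M :: "'a pmf" and X :: "'a \<Rightarrow> int" and m s :: real
  assumes "s \<ge> 0"
  shows "bdd_above (range (\<lambda>k::int. \<bar>measure_pmf.prob M {I. X I = k}
           - 1 / (sqrt (2 * pi) * s) * exp (- (real_of_int k - m)\<^sup>2 / (2 * s\<^sup>2))\<bar>))"
proof (rule bdd_aboveI2)
  fix k :: int
  let ?c = "1 / (sqrt (2 * pi) * s)" and ?e = "exp (- (real_of_int k - m)\<^sup>2 / (2 * s\<^sup>2))"
  have c: "0 \<le> ?c" using assms by simp
  have "?c * ?e \<le> ?c * 1" by (rule mult_left_mono[OF _ c]) simp
  moreover have "0 \<le> ?c * ?e" using c by (rule mult_nonneg_nonneg) simp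
  moreover have "0 \<le> measure_pmf.prob M {I. X I = k}" "measure_pmf.prob M {I. X I = k} \<le> 1"
    by simp_all
  ultimately show "\<bar>measure_pmf.prob M {I. X I = k} - ?c * ?e\<bar> \<le> 1 + ?c"
    by linarith
qed

end

theory Submission
  imports Defs "HOL-Computational_Algebra.Fundamental_Theorem_Algebra"
begin

text \<open>
  The independence polynomial of a graph of maximum degree \<open>\<Delta>\<close> has no zeros in the disc of radius
  \<open>1 / (4\<Delta>)\<close>, so it factors as a product of at most \<open>n\<close> terms \<open>1 + a\<^sub>j z\<close> with \<open>\<bar>a\<^sub>j\<bar> \<le> 4\<Delta>\<close> and
  \<open>\<Sum> a\<^sub>j = n\<close>. Hence the probability generating function of the size is \<open>\<Prod> (1 + q\<^sub>j (z - 1))\<close> with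
  \<open>q\<^sub>j = a\<^sub>j \<lambda> / (1 + a\<^sub>j \<lambda>)\<close>, as if the size were a sum of independent Bernoulli variables with complex
  parameters \<open>q\<^sub>j\<close>. For \<open>\<lambda> \<le> 1 / (100\<Delta>\<^sup>2)\<close> the sum \<open>\<Sum> \<bar>q\<^sub>j\<bar>\<^sup>2\<close> is a small fraction of
  \<open>n\<lambda>\<close>, so mean \<open>\<Sum> q\<^sub>j\<close> and variance \<open>\<Sum> q\<^sub>j (1 - q\<^sub>j)\<close> are of order \<open>n\<lambda>\<close>. As the mean is real, the
  characteristic function is at most \<open>exp (- (1 - cos t) (\<mu> - \<Sum> \<bar>q\<^sub>j\<bar>\<^sup>2))\<close> in modulus. This Gaussian
  bound dominates the integrand of the Fourier inversion formula on the whole period, while the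
  cumulant expansion gives its pointwise limit.
\<close>

section \<open>Fourier inversion and a local limit criterion\<close>

text \<open>For \<open>m\<close> nonzero the antiderivative \<open>F\<close> takes equal values at
  both ends of the period, since \<open>exp (2 * pi * m * \<i>) = 1\<close>. This is the
  orthogonality behind Fourier inversion.\<close>

lemma integral_iexp_int:
  fixes m :: int
  shows "set_integrable lborel {-pi..pi} (\<lambda>t. iexp (of_int m * t))"
    and "(LINT t:{-pi..pi}|lborel. iexp (of_int m * t)) = (if m = 0 then of_real (2 * pi) else 0)"
proof -
  let ?f = "\<lambda>t::real. iexp (of_int m * t)"
  show si: "set_integrable lborel {-pi..pi} ?f"
    by (intro borel_integrable_atLeastAtMost') (auto intro!: continuous_intros)
  have eq: "(LINT t:{-pi..pi}|lborel. ?f t) = integral {-pi..pi} ?f"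
    using set_borel_integral_eq_integral(2)[OF si] .
  show "(LINT t:{-pi..pi}|lborel. ?f t) = (if m = 0 then of_real (2 * pi) else 0)"
  proof (cases "m = 0")
    case True
    then show ?thesis unfolding eq by (simp add: scaleR_conv_of_real)
  next
    case False
    define F where "F = (\<lambda>t::real. iexp (of_int m * t) / (\<i> * of_int m))"
    have "((\<lambda>z. exp (\<i> * of_int m * z) / (\<i> * of_int m)) has_field_derivative
        exp (\<i> * of_int m * of_real t)) (at (of_real t))" for t
      using False by (auto intro!: derivative_eq_intros)
    from has_vector_derivative_real_field[OF this]
    have der: "(F has_vector_derivative ?f t) (at t within {-pi..pi})" for t
      by (simp add: F_def mult_ac)
    have "(?f has_integral (F pi - F (-pi))) {-pi..pi}"
      by (rule fundamental_theorem_of_calculus) (use der in auto)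
    moreover have "F pi = F (-pi)"
    proof -
      have "iexp (of_int m * pi) = iexp (of_int m * (-pi)) * exp (2 * of_int m * of_real pi * \<i>)"
        unfolding exp_add[symmetric] by (rule arg_cong[of _ _ exp]) (simp add: algebra_simps)
      also have "exp (2 * of_int m * of_real pi * \<i>) = 1"
        using exp_integer_2pi[of "of_int m"] by (simp add: mult_ac)
      finally show ?thesis by (simp add: F_def)
    qed
    ultimately show ?thesis using False eq by (simp add: integral_unique)
  qed
qed

text \<open>With finite support the expectation is a finite sum, so sum and integral commute, and
  orthogonality keeps exactly the atoms with \<open>X a = k\<close>.\<close>

lemma pmf_fourier_inversion:
  fixes M :: "'b pmf" and X :: "'b \<Rightarrow> int"
  assumes "finite (set_pmf M)"
  shows "set_integrable lborel {-pi..pi}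
           (\<lambda>t. measure_pmf.expectation M (\<lambda>a. iexp (t * X a)) * iexp (- (t * k)))"
    and "complex_of_real (measure_pmf.prob M {a. X a = k}) =
     (LINT t:{-pi..pi}|lborel. measure_pmf.expectation M (\<lambda>a. iexp (t * X a)) * iexp (- (t * k)))
       / (2 * pi)"
proof -
  have E: "measure_pmf.expectation M (\<lambda>a. iexp (t * X a)) * iexp (- (t * k))
        = (\<Sum>a\<in>set_pmf M. of_real (pmf M a) * iexp (of_int (X a - k) * t))" for t :: real
  proof -
    have "iexp (of_int (X a - k) * t) = iexp (t * X a) * iexp (- (t * k))" for a
      unfolding exp_add[symmetric] by (rule arg_cong[of _ _ exp]) (simp add: algebra_simps)
    then show ?thesis
      by (subst integral_measure_pmf[OF assms])
         (auto simp only: scaleR_conv_of_real sum_distrib_right mult.assoc)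
  qed
  have si: "set_integrable lborel {-pi..pi} (\<lambda>t. complex_of_real (pmf M a) * iexp (of_int (X a - k) * t))" for a
    by (rule set_integrable_mult_right) (rule integral_iexp_int)
  show "set_integrable lborel {-pi..pi}
           (\<lambda>t. measure_pmf.expectation M (\<lambda>a. iexp (t * X a)) * iexp (- (t * k)))"
    using si unfolding E set_integrable_def scaleR_sum_right
    by (intro Bochner_Integration.integrable_sum) auto
  have "(LINT t:{-pi..pi}|lborel. measure_pmf.expectation M (\<lambda>a. iexp (t * X a)) * iexp (- (t * k)))
     = (\<Sum>a\<in>set_pmf M. LINT t:{-pi..pi}|lborel. of_real (pmf M a) * iexp (of_int (X a - k) * t))"
    using si unfolding E set_lebesgue_integral_def set_integrable_def scaleR_sum_right
    by (intro Bochner_Integration.integral_sum) auto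
  also have "\<dots> = (\<Sum>a\<in>set_pmf M. of_real (pmf M a) * (LINT t:{-pi..pi}|lborel. iexp (of_int (X a - k) * t)))"
    by (simp only: set_integral_mult_right)
  also have "\<dots> = (\<Sum>a\<in>set_pmf M. if X a = k then complex_of_real (pmf M a) * (2 * pi) else 0)"
    by (intro sum.cong refl, subst integral_iexp_int(2)) auto
  also have "\<dots> = (\<Sum>a\<in>set_pmf M \<inter> {a. X a = k}. complex_of_real (pmf M a)) * (2 * pi)"
    using assms by (subst sum.inter_restrict) (auto simp: sum_distrib_right intro!: sum.cong)
  also have "(\<Sum>a\<in>set_pmf M \<inter> {a. X a = k}. complex_of_real (pmf M a)) = 
     of_real (measure_pmf.prob M {a. X a = k})"
  proof -
    have "measure_pmf.prob M {a. X a = k} = measure_pmf.prob M (set_pmf M \<inter> {a. X a = k})"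
      by (metis measure_Int_set_pmf inf_commute)
    then show ?thesis using assms by (subst (asm) measure_measure_pmf_finite) auto
  qed
  finally show "complex_of_real (measure_pmf.prob M {a. X a = k}) =
     (LINT t:{-pi..pi}|lborel. measure_pmf.expectation M (\<lambda>a. iexp (t * X a)) * iexp (- (t * k)))
       / (2 * pi)" by simp
qed

text \<open>A rescaling of the known characteristic function of the standard normal law. It writes
  the Gaussian term of the limit theorem as an integral of the same shape as the inversion
  formula.\<close>

lemma gaussian_fourier:
  shows "integrable lborel (\<lambda>x::real. exp (- x\<^sup>2 / 2))"
    and "(LINT x|lborel. complex_of_real (exp (- x\<^sup>2 / 2)) * iexp (x * y)) =
         sqrt (2 * pi) * exp (- y\<^sup>2 / 2)"
proof -
  have e: "exp (- x\<^sup>2 / 2) = sqrt (2 * pi) * std_normal_density x" for x :: real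
    by (simp add: std_normal_density_def)
  show "integrable lborel (\<lambda>x::real. exp (- x\<^sup>2 / 2))"
    unfolding e by (intro integrable_mult_right integrable_normal_density) auto
  have "char std_normal_distribution y = (LINT x|lborel. std_normal_density x *\<^sub>R iexp (y * x))"
    unfolding char_def by (subst integral_density) (auto simp: normal_density_nonneg)
  then have "complex_of_real (exp (- y\<^sup>2 / 2)) = (LINT x|lborel. std_normal_density x *\<^sub>R iexp (y * x))"
    by (simp add: char_std_normal_distribution)
  then have "of_real (sqrt (2 * pi)) * complex_of_real (exp (- y\<^sup>2 / 2))
     = (LINT x|lborel. of_real (sqrt (2 * pi)) * (std_normal_density x *\<^sub>R iexp (y * x)))"
    by (simp only: integral_mult_right_zero)
  also have "\<dots> = (LINT x|lborel. complex_of_real (exp (- x\<^sup>2 / 2)) * iexp (x * y))"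
    unfolding e by (intro Bochner_Integration.integral_cong) (auto simp: scaleR_conv_of_real mult_ac)
  finally show "(LINT x|lborel. complex_of_real (exp (- x\<^sup>2 / 2)) * iexp (x * y)) =
         sqrt (2 * pi) * exp (- y\<^sup>2 / 2)" by simp
qed

text \<open>After the substitution \<open>t = x / s\<close>, point probability and Gaussian density
  are Fourier integrals against the same character \<open>iexp (x * y)\<close>. Taking the modulus
  inside the integral of the difference removes \<open>y\<close>, and with it \<open>k\<close>, so
  the bound is uniform in \<open>k\<close>.\<close>

lemma local_limit_error_le:
  fixes M :: "'b pmf" and X :: "'b \<Rightarrow> int" and s m :: real
  assumes fin: "finite (set_pmf M)" and s: "s > 0"
  defines "g \<equiv> \<lambda>x. indicator {-(pi * s)..pi * s} x *
       (measure_pmf.expectation M (\<lambda>a. iexp (x / s * X a)) * iexp (- (x / s * m)))"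
  shows "g \<in> borel_measurable borel"
    and "\<bar>measure_pmf.prob M {a. X a = k} 
           - 1 / (sqrt (2 * pi) * s) * exp (- (real_of_int k - m)\<^sup>2 / (2 * s\<^sup>2))\<bar>
         \<le> (LINT x|lborel. norm (g x - of_real (exp (- x\<^sup>2 / 2)))) / (2 * pi * s)"
proof -
  let ?\<phi> = "\<lambda>t::real. measure_pmf.expectation M (\<lambda>a. iexp (t * X a))"
  have phi: "?\<phi> t = (\<Sum>a\<in>set_pmf M. of_real (pmf M a) * iexp (t * X a))" for t
    by (subst integral_measure_pmf[OF fin]) (auto simp: scaleR_conv_of_real)
  show gm: "g \<in> borel_measurable borel"
    unfolding g_def phi by measurable
  \<comment> \<open>Chosen so that the inversion factor \<open>iexp (- (x / s * k))\<close> splits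
    into the centring factor contained in \<open>g\<close> and \<open>iexp (x * y)\<close>.\<close>
  define y where "y = - ((k - m) / s)"
  let ?h = "\<lambda>t. indicator {-pi..pi} t *\<^sub>R (?\<phi> t * iexp (- (t * k)))"
  have ind: "indicator {-pi..pi} (x / s) = (indicator {-(pi * s)..pi * s} x :: real)" for x
    using s by (auto simp: indicator_def field_simps)
  have hg: "?h (x / s) = g x * iexp (x * y)" for x
  proof -
    have "iexp (- (x / s * k)) = iexp (- (x / s * m)) * iexp (x * y)"
      using s by (simp add: y_def exp_add[symmetric] field_simps)
    then show ?thesis
      by (simp only: ind g_def) (auto simp: indicator_def)
  qed
  have arg: "0 + 1 / s * x = x / s" for x by simp
  have hi: "integrable lborel ?h"
    using pmf_fourier_inversion(1)[OF fin, of X k] by (simp add: set_integrable_def)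
  have gi: "integrable lborel (\<lambda>x. g x * iexp (x * y))"
    using lborel_integrable_real_affine[OF hi, of "1/s" 0] s unfolding arg hg by simp
  have P: "complex_of_real (measure_pmf.prob M {a. X a = k}) = 
      (LINT x|lborel. g x * iexp (x * y)) / (2 * pi * s)"
    using lborel_integral_real_affine[of "1/s" ?h 0] s
    unfolding arg hg pmf_fourier_inversion(2)[OF fin] set_lebesgue_integral_def
    by (simp add: scaleR_conv_of_real)
  have y2: "- (real_of_int k - m)\<^sup>2 / (2 * s\<^sup>2) = - y\<^sup>2 / 2"
    using s by (simp add: y_def power_divide)
  have sq: "complex_of_real (sqrt (2 * pi)) * of_real (sqrt (2 * pi)) = 2 * pi"
    by (simp only: of_real_mult[symmetric] real_sqrt_mult_self) simp
  have Gs: "complex_of_real (1 / (sqrt (2 * pi) * s) * exp (- (real_of_int k - m)\<^sup>2 / (2 * s\<^sup>2)))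
      = (LINT x|lborel. of_real (exp (- x\<^sup>2 / 2)) * iexp (x * y)) / (2 * pi * s)"
    unfolding gaussian_fourier(2) y2 using s sq
    by (simp add: field_simps)
  have Gi: "integrable lborel (\<lambda>x. complex_of_real (exp (- x\<^sup>2 / 2)) * iexp (x * y))"
  proof (rule Bochner_Integration.integrable_bound)
    show "integrable lborel (\<lambda>x::real. exp (- x\<^sup>2 / 2))" by (rule gaussian_fourier)
  qed (auto simp: norm_mult)
  have "complex_of_real (measure_pmf.prob M {a. X a = k}
           - 1 / (sqrt (2 * pi) * s) * exp (- (real_of_int k - m)\<^sup>2 / (2 * s\<^sup>2)))
     = (LINT x|lborel. (g x - of_real (exp (- x\<^sup>2 / 2))) * iexp (x * y)) / (2 * pi * s)"
    unfolding of_real_diff P Gs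
    by (simp only: left_diff_distrib Bochner_Integration.integral_diff[OF gi Gi] diff_divide_distrib)
  then have "\<bar>measure_pmf.prob M {a. X a = k}
           - 1 / (sqrt (2 * pi) * s) * exp (- (real_of_int k - m)\<^sup>2 / (2 * s\<^sup>2))\<bar>
      = norm (LINT x|lborel. (g x - of_real (exp (- x\<^sup>2 / 2))) * iexp (x * y)) / (2 * pi * s)"
    using s by (metis (no_types, lifting) norm_of_real norm_divide abs_of_pos mult_pos_pos pi_gt_zero zero_less_numeral)
  also have "\<dots> \<le> (LINT x|lborel. norm ((g x - of_real (exp (- x\<^sup>2 / 2))) * iexp (x * y))) / (2 * pi * s)"
    using s by (intro divide_right_mono integral_norm_bound) auto
  finally show "\<bar>measure_pmf.prob M {a. X a = k} 
           - 1 / (sqrt (2 * pi) * s) * exp (- (real_of_int k - m)\<^sup>2 / (2 * s\<^sup>2))\<bar>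
         \<le> (LINT x|lborel. norm (g x - of_real (exp (- x\<^sup>2 / 2)))) / (2 * pi * s)"
    by (simp add: norm_mult)
qed

text \<open>The error bound divided by \<open>1 / s n\<close> is an integral over the whole line
  that does not depend on \<open>k\<close>. Under \<open>t = x / s n\<close> the bound on the period
  becomes \<open>exp (- c * x\<^sup>2)\<close>, which is free of \<open>n\<close>, so dominated
  convergence applies with the pointwise limit \<open>clt\<close>.\<close>

theorem local_limit_criterion:
  fixes M :: "nat \<Rightarrow> 'b pmf" and X :: "'b \<Rightarrow> int" and m s :: "nat \<Rightarrow> real"
  assumes fin: "\<forall>\<^sub>F n in sequentially. finite (set_pmf (M n))"
    and s: "filterlim s at_top sequentially" and c: "c > 0"
    and bound: "\<forall>\<^sub>F n in sequentially. \<forall>t. \<bar>t\<bar> \<le> pi \<longrightarrow>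
       norm (measure_pmf.expectation (M n) (\<lambda>a. iexp (t * X a))) \<le> exp (- c * (s n)\<^sup>2 * t\<^sup>2)"
    and clt: "\<And>x. (\<lambda>n. measure_pmf.expectation (M n) (\<lambda>a. iexp (x / s n * X a))
        * iexp (- (x / s n * m n))) \<longlonglongrightarrow> of_real (exp (- x\<^sup>2 / 2))"
  shows "(\<lambda>n. SUP k::int. \<bar>measure_pmf.prob (M n) {a. X a = k}
            - 1 / (sqrt (2 * pi) * s n) * exp (- (real_of_int k - m n)\<^sup>2 / (2 * (s n)\<^sup>2))\<bar>)
         \<in> o[sequentially](\<lambda>n. 1 / s n)"
proof -
  define g where "g = (\<lambda>n x. indicator {-(pi * s n)..pi * s n} x *
       (measure_pmf.expectation (M n) (\<lambda>a. iexp (x / s n * X a)) * iexp (- (x / s n * m n))))"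
  define D where "D = (\<lambda>n. LINT x|lborel. norm (g n x - of_real (exp (- x\<^sup>2 / 2))))"
  have spos: "\<forall>\<^sub>F n in sequentially. s n > 0"
    using s by (rule eventually_compose_filterlim[OF eventually_gt_at_top])
  \<comment> \<open>Dominated convergence wants its bounds for every index, while the hypotheses
    hold only eventually; hence the shift by \<open>N\<close> below.\<close>
  obtain N where N: "\<And>n. n \<ge> N \<Longrightarrow> finite (set_pmf (M n))" "\<And>n. n \<ge> N \<Longrightarrow> s n > 0"
     "\<And>n t. n \<ge> N \<Longrightarrow> \<bar>t\<bar> \<le> pi \<Longrightarrow>
       norm (measure_pmf.expectation (M n) (\<lambda>a. iexp (t * X a))) \<le> exp (- c * (s n)\<^sup>2 * t\<^sup>2)"
    using eventually_conj[OF fin eventually_conj[OF spos bound]] unfolding eventually_sequentially by blast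
  have gb: "norm (g n x) \<le> exp (- c * x\<^sup>2)" if n: "n \<ge> N" for n x
  proof (cases "x \<in> {-(pi * s n)..pi * s n}")
    case True
    have "\<bar>x / s n\<bar> \<le> pi" using True N(2)[OF n] by (auto simp: abs_le_iff field_simps)
    from N(3)[OF n this] show ?thesis
      using True N(2)[OF n] by (simp add: g_def norm_mult power_divide)
  qed (simp add: g_def)
  have gm: "g n \<in> borel_measurable borel" if "n \<ge> N" for n
    unfolding g_def by (rule local_limit_error_le(1)) (use N that in auto)
  have "(\<lambda>n. D (n + N)) \<longlonglongrightarrow> (LINT x|(lborel :: real measure). 0)"
    unfolding D_def
  proof (rule integral_dominated_convergence[where w = "\<lambda>x. exp (- c * x\<^sup>2) + exp (- x\<^sup>2 / 2)"])
    show "integrable lborel (\<lambda>x::real. exp (- c * x\<^sup>2) + exp (- x\<^sup>2 / 2))"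
    proof (intro Bochner_Integration.integrable_add gaussian_fourier(1))
      show "integrable lborel (\<lambda>x::real. exp (- c * x\<^sup>2))"
        using lborel_integrable_real_affine[OF gaussian_fourier(1), of "sqrt (2 * c)" 0] c
        by (simp add: power_mult_distrib)
    qed
    show "AE x in lborel. norm (norm (g (n + N) x - of_real (exp (- x\<^sup>2 / 2))))
        \<le> exp (- c * x\<^sup>2) + exp (- x\<^sup>2 / 2)" for n
    proof (rule AE_I2)
      fix x :: real
      have "norm (g (n + N) x - of_real (exp (- x\<^sup>2 / 2))) \<le> norm (g (n + N) x) + exp (- x\<^sup>2 / 2)"
        by (rule order_trans[OF norm_triangle_ineq4]) simp
      then show "norm (norm (g (n + N) x - of_real (exp (- x\<^sup>2 / 2))))
        \<le> exp (- c * x\<^sup>2) + exp (- x\<^sup>2 / 2)"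
        using gb[of "n + N" x] by simp
    qed
    show "AE x in lborel. (\<lambda>n. norm (g (n + N) x - of_real (exp (- x\<^sup>2 / 2)))) \<longlonglongrightarrow> 0"
    proof (rule AE_I2)
      fix x :: real
      \<comment> \<open>From then on \<open>x\<close> lies inside the window
        \<open>{-(pi * s n)..pi * s n}\<close> and the indicator in \<open>g\<close> equals
        1.\<close>
      have "\<forall>\<^sub>F n in sequentially. s n \<ge> \<bar>x\<bar> / pi"
        using s by (rule eventually_compose_filterlim[OF eventually_ge_at_top])
      then have "\<forall>\<^sub>F n in sequentially. measure_pmf.expectation (M n) (\<lambda>a. iexp (x / s n * X a))
        * iexp (- (x / s n * m n)) = g n x"
        by eventually_elim (auto simp: g_def indicator_def field_simps)
      then have "(\<lambda>n. g n x) \<longlonglongrightarrow> of_real (exp (- x\<^sup>2 / 2))"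
        using clt[of x] by (rule Lim_transform_eventually[rotated])
      then have "(\<lambda>n. norm (g n x - of_real (exp (- x\<^sup>2 / 2)))) \<longlonglongrightarrow> 0"
        using LIM_zero tendsto_norm_zero by blast
      then show "(\<lambda>n. norm (g (n + N) x - of_real (exp (- x\<^sup>2 / 2)))) \<longlonglongrightarrow> 0"
        by (rule LIMSEQ_ignore_initial_segment)
    qed
    show "(\<lambda>x. norm (g (n + N) x - of_real (exp (- x\<^sup>2 / 2)))) \<in> borel_measurable lborel" for n
      using gm[of "n + N"] by simp
  qed simp
  then have D0: "D \<longlonglongrightarrow> 0" by (simp add: LIMSEQ_offset)
  show ?thesis
  proof (rule landau_o.smallI)
    fix e :: real assume e: "e > 0"
    have "\<forall>\<^sub>F n in sequentially. D n < 2 * pi * e"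
      using D0 e by (intro order_tendstoD) auto
    then show "\<forall>\<^sub>F n in sequentially. norm (SUP k::int. \<bar>measure_pmf.prob (M n) {a. X a = k}
            - 1 / (sqrt (2 * pi) * s n) * exp (- (real_of_int k - m n)\<^sup>2 / (2 * (s n)\<^sup>2))\<bar>)
            \<le> e * norm (1 / s n)"
      using eventually_ge_at_top[of N]
    proof eventually_elim
      case (elim n)
      let ?f = "\<lambda>k::int. \<bar>measure_pmf.prob (M n) {a. X a = k}
            - 1 / (sqrt (2 * pi) * s n) * exp (- (real_of_int k - m n)\<^sup>2 / (2 * (s n)\<^sup>2))\<bar>"
      note sn = N(2)[OF elim(2)]
      have "?f k \<le> e / s n" for k
      proof -
        have "?f k \<le> D n / (2 * pi * s n)"
          unfolding D_def g_def by (rule local_limit_error_le(2)[OF N(1)[OF elim(2)] sn])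
        also have "\<dots> \<le> 2 * pi * e / (2 * pi * s n)"
          using sn elim(1) by (intro divide_right_mono) auto
        finally show ?thesis by simp
      qed
      then have "(SUP k. ?f k) \<le> e / s n" by (intro cSUP_least) auto
      \<comment> \<open>The little-o bound concerns the absolute value of the supremum. Its sign is
        read off from the term \<open>k = 0\<close>, which needs boundedness of the range.\<close>
      moreover have "0 \<le> (SUP k. ?f k)"
        by (rule cSUP_upper2[OF bdd_above_lclt_error, of _ 0]) (use sn in auto)
      ultimately show ?case using sn by simp
    qed
  qed
qed

section \<open>Products of complex Bernoulli factors\<close>

text \<open>By the half-angle formula \<open>1 - cos t\<close> is twice the square of
  \<open>sin y\<close> with \<open>y = t / 2\<close>. The Taylor error
  \<open>\<bar>y\<bar> ^ 3 / 6\<close> is at most two thirds of \<open>\<bar>y\<bar>\<close> when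
  \<open>\<bar>y\<bar> \<le> 2\<close>, so \<open>\<bar>sin y\<bar> \<ge> \<bar>y\<bar> / 3\<close>,
  which gives the constant 18.\<close>

lemma one_minus_cos_ge:
  fixes t :: real
  assumes "\<bar>t\<bar> \<le> pi"
  shows "t\<^sup>2 / 18 \<le> 1 - cos t"
proof -
  define y where "y = t / 2"
  have y: "\<bar>y\<bar> \<le> 2" using assms pi_less_4 by (simp add: y_def)
  have "cmod (iexp y - (\<Sum>k\<le>2. (\<i> * y) ^ k / fact k)) \<le> \<bar>y\<bar> ^ 3 / 6"
    using iexp_approx1[of y 2] by (simp add: fact_numeral numeral_eq_Suc)
  then have "\<bar>Im (iexp y - (\<Sum>k\<le>2. (\<i> * y) ^ k / fact k))\<bar> \<le> \<bar>y\<bar> ^ 3 / 6"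
    using abs_Im_le_cmod order_trans by blast
  moreover have "(\<Sum>k\<le>2. (\<i> * y) ^ k / fact k) = Complex (1 - y\<^sup>2 / 2) y"
    by (simp add: numeral_2_eq_2 complex_eq_iff)
  ultimately have "\<bar>sin y - y\<bar> \<le> \<bar>y\<bar> ^ 3 / 6" by (simp add: Im_exp)
  moreover have "\<bar>y\<bar> ^ 3 \<le> 4 * \<bar>y\<bar>"
    using mult_right_mono[OF power_mono[OF y, of 2], of "\<bar>y\<bar>"] by (simp add: power3_eq_cube power2_eq_square)
  ultimately have "\<bar>sin y - y\<bar> \<le> 2 / 3 * \<bar>y\<bar>" by simp
  then have "\<bar>y\<bar> / 3 \<le> \<bar>sin y\<bar>" by linarith
  then have "(\<bar>y\<bar> / 3)\<^sup>2 \<le> \<bar>sin y\<bar>\<^sup>2" by (rule power_mono) simp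
  then have "y\<^sup>2 / 9 \<le> (sin y)\<^sup>2" by (simp add: power_divide)
  moreover have "cos t = 1 - 2 * (sin y)\<^sup>2"
    using cos_double_sin[of y] by (simp add: y_def)
  ultimately show ?thesis by (simp add: y_def power_divide)
qed

text \<open>The error has derivative \<open>z\<^sup>2 / (1 + z)\<close>, and
  \<open>norm (1 + z) \<ge> 1 / 2\<close> on the disc of radius \<open>norm u\<close>. The mean
  value inequality supplies the third factor \<open>norm u\<close>.\<close>

lemma norm_Ln_minus_quadratic_le:
  fixes u :: complex
  assumes "norm u \<le> 1 / 2"
  shows "norm (Ln (1 + u) - u + u\<^sup>2 / 2) \<le> 2 * norm u ^ 3"
proof -
  let ?g = "\<lambda>z::complex. Ln (1 + z) - z + z\<^sup>2 / 2"
  have nz: "1 + z \<noteq> 0 \<and> 1 + z \<notin> \<real>\<^sub>\<le>\<^sub>0 \<and> norm (1 + z) \<ge> 1 / 2" if "norm z \<le> norm u" for z :: complex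
  proof -
    have "\<bar>Re z\<bar> \<le> 1 / 2" using that assms abs_Re_le_cmod[of z] by linarith
    then have "Re (1 + z) \<ge> 1 / 2" by simp
    then show ?thesis
      using complex_Re_le_cmod[of "1 + z"] by (auto simp: complex_nonpos_Reals_iff complex_eq_iff)
  qed
  have "norm (?g u - ?g 0) \<le> 2 * norm u ^ 2 * norm (u - 0)"
  proof (rule field_differentiable_bound[where S = "cball 0 (norm u)" and f' = "\<lambda>z. z\<^sup>2 / (1 + z)"])
    fix z :: complex assume "z \<in> cball 0 (norm u)"
    then have z: "norm z \<le> norm u" by simp
    note n = nz[OF this]
    show "(?g has_field_derivative z\<^sup>2 / (1 + z)) (at z within cball 0 (norm u))"
      by (rule derivative_eq_intros refl | use n in force)+
         (use n in \<open>simp add: field_simps power2_eq_square\<close>)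
    have "norm (z\<^sup>2 / (1 + z)) = norm z ^ 2 / norm (1 + z)" by (simp add: norm_divide norm_power)
    also have "\<dots> \<le> norm u ^ 2 / (1 / 2)"
      using n z by (intro frac_le power_mono) auto
    finally show "norm (z\<^sup>2 / (1 + z)) \<le> 2 * norm u ^ 2" by simp
  qed auto
  then show ?thesis by (simp add: power3_eq_cube power2_eq_square)
qed

text \<open>The subtracted terms come from the first two cumulants \<open>q\<close> and
  \<open>q * (1 - q)\<close> of a Bernoulli variable, continued to complex \<open>q\<close>. The
  error is kept linear in \<open>norm q\<close>, so that summing over many factors only involves the
  sum of the \<open>norm (q j)\<close>.\<close>

lemma norm_Ln_bernoulli_cumulant_le:
  fixes q :: complex and t :: real
  assumes q: "norm q \<le> 1 / 2" and t: "\<bar>t\<bar> \<le> 1"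
  shows "1 + q * (iexp t - 1) \<noteq> 0"
    and "norm (Ln (1 + q * (iexp t - 1)) - \<i> * t * q + q * (1 - q) * t\<^sup>2 / 2) \<le> 3 * norm q * \<bar>t\<bar> ^ 3"
proof -
  define w where "w = iexp t - 1"
  have w1: "norm w \<le> \<bar>t\<bar>"
    using iexp_approx1[of t 0] by (simp add: w_def)
  have w2: "norm (w - \<i> * t) \<le> \<bar>t\<bar> ^ 2 / 2"
    using iexp_approx1[of t 1] by (simp add: w_def numeral_2_eq_2 diff_diff_eq)
  have w3: "norm (w - \<i> * t + t\<^sup>2 / 2) \<le> \<bar>t\<bar> ^ 3 / 6"
    using iexp_approx1[of t 2]
    by (simp add: w_def numeral_2_eq_2 numeral_3_eq_3 algebra_simps fact_numeral power_mult_distrib)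
  \<comment> \<open>Factoring as a difference of squares gives one factor of second order and one of
    first order in \<open>t\<close>.\<close>
  have w4: "norm (w\<^sup>2 + t\<^sup>2) \<le> \<bar>t\<bar> ^ 3"
  proof -
    have "w\<^sup>2 + complex_of_real (t\<^sup>2) = (w - \<i> * t) * (w + \<i> * t)"
      by (simp add: algebra_simps power2_eq_square)
    moreover have "norm (w + \<i> * t) \<le> 2 * \<bar>t\<bar>"
      using norm_triangle_ineq[of w "\<i> * t"] w1 by (simp add: norm_mult)
    ultimately have "norm (w\<^sup>2 + t\<^sup>2) \<le> (\<bar>t\<bar> ^ 2 / 2) * (2 * \<bar>t\<bar>)"
      using w2 by (simp only: norm_mult) (intro mult_mono, auto)
    then show ?thesis by (simp add: power3_eq_cube power2_eq_square)
  qed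
  define u where "u = q * w"
  have u: "norm u \<le> norm q * \<bar>t\<bar>"
    unfolding u_def norm_mult by (intro mult_left_mono w1) auto
  also have "\<dots> \<le> 1 / 2 * 1" using q t by (intro mult_mono) auto
  finally have u2: "norm u \<le> 1 / 2" by simp
  show "1 + q * (iexp t - 1) \<noteq> 0"
  proof
    assume "1 + q * (iexp t - 1) = 0"
    then have "u = -1" by (simp add: u_def w_def algebra_simps eq_neg_iff_add_eq_0)
    with u2 show False by simp
  qed
  have q2: "norm q ^ 2 \<le> norm q / 2"
    using mult_left_mono[OF q, of "norm q"] by (simp add: power2_eq_square)
  have q3: "norm q ^ 3 \<le> norm q / 2"
  proof -
    have "norm q ^ 3 \<le> norm q ^ 2" using q by (intro power_decreasing) auto
    then show ?thesis using q2 by simp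
  qed
  \<comment> \<open>The remainder splits into the error of the logarithm at \<open>u\<close>, the
    error of \<open>w\<close> as a quadratic in \<open>t\<close>, and the error of replacing
    \<open>w\<^sup>2\<close> by \<open>- t\<^sup>2\<close>.\<close>
  have "Ln (1 + q * (iexp t - 1)) - \<i> * t * q + q * (1 - q) * t\<^sup>2 / 2
    = (Ln (1 + u) - u + u\<^sup>2 / 2) + q * (w - \<i> * t + t\<^sup>2 / 2) - q\<^sup>2 / 2 * (w\<^sup>2 + t\<^sup>2)"
    by (simp add: u_def w_def field_simps power2_eq_square)
  also have "norm \<dots> \<le> norm (Ln (1 + u) - u + u\<^sup>2 / 2) + norm (q * (w - \<i> * t + t\<^sup>2 / 2))
      + norm (q\<^sup>2 / 2 * (w\<^sup>2 + t\<^sup>2))"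
    by (meson add_right_mono norm_triangle_ineq norm_triangle_ineq4 order_trans)
  also have "\<dots> \<le> 2 * (norm q ^ 3 * \<bar>t\<bar> ^ 3) + norm q * (\<bar>t\<bar> ^ 3 / 6) + norm q ^ 2 / 2 * \<bar>t\<bar> ^ 3"
  proof (intro add_mono)
    have "norm (Ln (1 + u) - u + u\<^sup>2 / 2) \<le> 2 * norm u ^ 3"
      by (rule norm_Ln_minus_quadratic_le[OF u2])
    also have "\<dots> \<le> 2 * (norm q * \<bar>t\<bar>) ^ 3"
      using u by (intro mult_left_mono power_mono) auto
    finally show "norm (Ln (1 + u) - u + u\<^sup>2 / 2) \<le> 2 * (norm q ^ 3 * \<bar>t\<bar> ^ 3)"
      by (simp add: power_mult_distrib)
    show "norm (q * (w - \<i> * t + t\<^sup>2 / 2)) \<le> norm q * (\<bar>t\<bar> ^ 3 / 6)"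
      unfolding norm_mult by (intro mult_left_mono w3) auto
    show "norm (q\<^sup>2 / 2 * (w\<^sup>2 + t\<^sup>2)) \<le> norm q ^ 2 / 2 * \<bar>t\<bar> ^ 3"
      unfolding norm_mult norm_divide norm_power using w4 by (intro mult_mono) auto
  qed
  also have "\<dots> \<le> 2 * (norm q / 2 * \<bar>t\<bar> ^ 3) + norm q * (\<bar>t\<bar> ^ 3 / 6) + norm q / 2 / 2 * \<bar>t\<bar> ^ 3"
    by (intro add_mono mult_left_mono mult_right_mono divide_right_mono q2 q3 order_refl) auto
  \<comment> \<open>The three contributions add up to \<open>1 + 1 / 6 + 1 / 4\<close>, below
    3.\<close>
  also have "\<dots> \<le> 3 * norm q * \<bar>t\<bar> ^ 3"
  proof -
    have "0 \<le> norm q * \<bar>t\<bar> ^ 3" by simp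
    then show ?thesis by (simp add: field_simps)
  qed
  finally show "norm (Ln (1 + q * (iexp t - 1)) - \<i> * t * q + q * (1 - q) * t\<^sup>2 / 2) \<le> 3 * norm q * \<bar>t\<bar> ^ 3" .
qed

text \<open>With \<open>w = iexp t - 1\<close>, each squared modulus is
  \<open>1 + 2 * Re (q j * w) + norm (q j * w) ^ 2\<close>, hence at most the exponential of the
  last two terms. The exponents add up; as the sum of the \<open>q j\<close> is the real number
  \<open>m\<close>, only \<open>Re w = - (1 - cos t)\<close> enters the linear part, and
  \<open>norm w ^ 2 = 2 * (1 - cos t)\<close>.\<close>

lemma norm_prod_bernoulli_char_le:
  fixes q :: "'i \<Rightarrow> complex" and t m :: real
  assumes m: "(\<Sum>j\<in>J. q j) = of_real m"
  shows "norm (\<Prod>j\<in>J. 1 + q j * (iexp t - 1)) \<le> exp (- (1 - cos t) * (m - (\<Sum>j\<in>J. norm (q j) ^ 2)))"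
proof -
  define w where "w = iexp t - 1"
  have Re_w: "Re w = - (1 - cos t)" by (simp add: w_def Re_exp)
  have w2: "norm w ^ 2 = 2 * (1 - cos t)"
    unfolding cmod_power2 using sin_cos_squared_add[of t]
    by (simp add: w_def Re_exp Im_exp power2_eq_square algebra_simps)
  have "norm (1 + q j * w) ^ 2 \<le> exp (2 * Re (q j * w) + norm (q j) ^ 2 * norm w ^ 2)" for j
  proof -
    have "norm (1 + q j * w) ^ 2 = 1 + (2 * Re (q j * w) + norm (q j * w) ^ 2)"
      unfolding cmod_power2 by (simp add: power2_eq_square algebra_simps)
    also have "\<dots> \<le> exp (2 * Re (q j * w) + norm (q j * w) ^ 2)" by (rule exp_ge_add_one_self)
    finally show ?thesis by (simp add: norm_mult power_mult_distrib)
  qed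
  then have "(\<Prod>j\<in>J. norm (1 + q j * w) ^ 2) \<le> (\<Prod>j\<in>J. exp (2 * Re (q j * w) + norm (q j) ^ 2 * norm w ^ 2))"
    by (intro prod_mono) auto
  also have "\<dots> = exp (2 * Re ((\<Sum>j\<in>J. q j) * w) + (\<Sum>j\<in>J. norm (q j) ^ 2) * norm w ^ 2)"
  \<comment> \<open>For infinite \<open>J\<close> the product defaults to 1 and the sums to 0, so
    both sides equal 1.\<close>
  proof (cases "finite J")
    case True
    then have "(\<Prod>j\<in>J. exp (2 * Re (q j * w) + norm (q j) ^ 2 * norm w ^ 2)) =
      exp (\<Sum>j\<in>J. 2 * Re (q j * w) + norm (q j) ^ 2 * norm w ^ 2)" by (simp add: exp_sum)
    then show ?thesis by (simp only: sum.distrib sum_distrib_left sum_distrib_right Re_sum)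
  qed auto
  also have "\<dots> = exp (- (1 - cos t) * (m - (\<Sum>j\<in>J. norm (q j) ^ 2))) ^ 2"
    unfolding m w2 by (simp add: Re_w exp_double[symmetric] algebra_simps)
  finally have "norm (\<Prod>j\<in>J. 1 + q j * w) ^ 2 \<le> exp (- (1 - cos t) * (m - (\<Sum>j\<in>J. norm (q j) ^ 2))) ^ 2"
    by (simp only: prod_norm[symmetric] prod_power_distrib)
  then show ?thesis unfolding w_def by (rule power2_le_imp_le) simp
qed

section \<open>Moments and local limit theorem for a factored generating function\<close>

text \<open>These are the first two elementary symmetric functions; the second is expressed through
  power sums by Newton's identity, doubled to avoid a division.\<close>

lemma coeff_prod_linear:
  fixes q :: "'i \<Rightarrow> 'a :: comm_ring_1"
  assumes "finite J"
  shows "coeff (\<Prod>j\<in>J. [:1, q j:]) 1 = (\<Sum>j\<in>J. q j)"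
    and "2 * coeff (\<Prod>j\<in>J. [:1, q j:]) 2 = (\<Sum>j\<in>J. q j)\<^sup>2 - (\<Sum>j\<in>J. (q j)\<^sup>2)"
proof -
  have "coeff (\<Prod>j\<in>J. [:1, q j:]) 0 = 1 \<and> coeff (\<Prod>j\<in>J. [:1, q j:]) 1 = (\<Sum>j\<in>J. q j)
     \<and> 2 * coeff (\<Prod>j\<in>J. [:1, q j:]) 2 = (\<Sum>j\<in>J. q j)\<^sup>2 - (\<Sum>j\<in>J. (q j)\<^sup>2)"
    using assms
  proof induction
    case empty
    then show ?case by simp
  next
    case (insert x F)
    then show ?case
      by (auto simp: numeral_2_eq_2 coeff_pCons power2_eq_square algebra_simps)
  qed
  then show "coeff (\<Prod>j\<in>J. [:1, q j:]) 1 = (\<Sum>j\<in>J. q j)"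
    and "2 * coeff (\<Prod>j\<in>J. [:1, q j:]) 2 = (\<Sum>j\<in>J. q j)\<^sup>2 - (\<Sum>j\<in>J. (q j)\<^sup>2)" by blast+
qed

text \<open>Substituting \<open>z = 1 + x\<close> turns the generating function into a polynomial in
  \<open>x\<close> whose coefficients are the binomial moments, the expectations of
  \<open>X a choose i\<close>. Comparing the coefficients at 1 and 2 gives the usual Bernoulli
  formulas even for complex \<open>q\<close>.\<close>

lemma moments_of_factored_pgf:
  fixes M :: "'b pmf" and X :: "'b \<Rightarrow> nat" and q :: "'i \<Rightarrow> complex"
  assumes fin: "finite (set_pmf M)" "finite J"
    and pgf: "\<And>z::complex. measure_pmf.expectation M (\<lambda>a. z ^ X a) = (\<Prod>j\<in>J. 1 + q j * (z - 1))"
  shows "complex_of_real (measure_pmf.expectation M (\<lambda>a. real (X a))) = (\<Sum>j\<in>J. q j)"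
    and "complex_of_real (measure_pmf.variance M (\<lambda>a. real (X a))) = (\<Sum>j\<in>J. q j * (1 - q j))"
proof -
  let ?P = "\<Sum>a\<in>set_pmf M. smult (complex_of_real (pmf M a)) ([:1, 1:] ^ X a)"
  have E: "measure_pmf.expectation M f = (\<Sum>a\<in>set_pmf M. of_real (pmf M a) * f a)" for f :: "'b \<Rightarrow> complex"
    by (subst integral_measure_pmf[OF fin(1)]) (auto simp: scaleR_conv_of_real)
  have ER: "measure_pmf.expectation M f = (\<Sum>a\<in>set_pmf M. pmf M a * f a)" for f :: "'b \<Rightarrow> real"
    by (subst integral_measure_pmf[OF fin(1)]) auto
  have P: "?P = (\<Prod>j\<in>J. [:1, q j:])"
  proof (subst poly_eq_poly_eq_iff[symmetric], rule ext)
    fix x :: complex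
    show "poly ?P x = poly (\<Prod>j\<in>J. [:1, q j:]) x"
      using pgf[of "1 + x"] unfolding E by (simp add: poly_sum poly_prod poly_power mult_ac)
  qed
  have c: "coeff ([:1, 1:] ^ n :: complex poly) i = of_nat (n choose i)" for n i
  proof (cases "i \<le> n")
    case True then show ?thesis by (simp add: coeff_linear_poly_power)
  next
    case False
    have "degree ([:1, 1:] ^ n :: complex poly) \<le> n"
      by (rule order_trans[OF degree_power_le]) simp
    with False show ?thesis by (simp add: coeff_eq_0 binomial_eq_0)
  qed
  show 1: "complex_of_real (measure_pmf.expectation M (\<lambda>a. real (X a))) = (\<Sum>j\<in>J. q j)"
    using arg_cong[OF P, of "\<lambda>p. coeff p 1"] coeff_prod_linear(1)[OF fin(2), of q]
    by (simp add: ER coeff_sum c)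
  have sq: "real (X a) ^ 2 = 2 * real (X a choose 2) + real (X a)" for a
  proof -
    have "2 * (X a choose 2) = X a * (X a - 1)" 
      by (cases "X a") (simp_all add: choose_two)
    then have "2 * real (X a choose 2) = real (X a) * real (X a - 1)"
      by (metis of_nat_mult of_nat_numeral)
    then show ?thesis by (cases "X a") (auto simp: power2_eq_square algebra_simps)
  qed
  have "(\<Sum>a\<in>set_pmf M. complex_of_real (pmf M a) * of_nat (X a choose 2)) = coeff ?P 2"
    by (simp add: coeff_sum c)
  then have F: "2 * (\<Sum>a\<in>set_pmf M. complex_of_real (pmf M a) * of_nat (X a choose 2))
     = (\<Sum>j\<in>J. q j)\<^sup>2 - (\<Sum>j\<in>J. (q j)\<^sup>2)"
    using coeff_prod_linear(2)[OF fin(2), of q] unfolding P by simp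
  have "measure_pmf.variance M (\<lambda>a. real (X a)) = measure_pmf.expectation M (\<lambda>a. real (X a) ^ 2)
      - (measure_pmf.expectation M (\<lambda>a. real (X a)))\<^sup>2"
    by (rule measure_pmf.variance_eq) (auto intro: integrable_measure_pmf_finite fin)
  also have "measure_pmf.expectation M (\<lambda>a. real (X a) ^ 2) 
      = 2 * (\<Sum>a\<in>set_pmf M. pmf M a * real (X a choose 2)) + measure_pmf.expectation M (\<lambda>a. real (X a))"
    unfolding ER sq by (simp add: algebra_simps sum.distrib sum_distrib_left)
  finally have "complex_of_real (measure_pmf.variance M (\<lambda>a. real (X a))) =
     2 * (\<Sum>a\<in>set_pmf M. complex_of_real (pmf M a) * of_nat (X a choose 2)) + (\<Sum>j\<in>J. q j) - (\<Sum>j\<in>J. q j)\<^sup>2"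
    by (simp add: 1)
  then show "complex_of_real (measure_pmf.variance M (\<lambda>a. real (X a))) = (\<Sum>j\<in>J. q j * (1 - q j))"
    unfolding F by (simp add: algebra_simps sum_subtractf power2_eq_square)
qed

text \<open>\<open>gap\<close> makes the modulus bound for the product Gaussian on the whole period,
  and \<open>abs\<close> makes the summed cumulant errors of order \<open>1 / s n\<close>. These are
  the two inputs of the local limit criterion.\<close>

theorem factored_pgf_local_limit:
  fixes M :: "nat \<Rightarrow> 'b pmf" and X :: "'b \<Rightarrow> nat" and m s :: "nat \<Rightarrow> real"
    and J :: "nat \<Rightarrow> 'i set" and q :: "nat \<Rightarrow> 'i \<Rightarrow> complex" and K L :: real
  assumes mean: "\<And>n. m n = measure_pmf.expectation (M n) (\<lambda>a. real (X a))"
    and sd: "\<And>n. s n = sqrt (measure_pmf.variance (M n) (\<lambda>a. real (X a)))"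
    and s: "filterlim s at_top sequentially" and L: "L > 0"
    and fin: "\<forall>\<^sub>F n in sequentially. finite (set_pmf (M n)) \<and> finite (J n)"
    and pgf: "\<forall>\<^sub>F n in sequentially. \<forall>z::complex.
       measure_pmf.expectation (M n) (\<lambda>a. z ^ X a) = (\<Prod>j\<in>J n. 1 + q n j * (z - 1))"
    and half: "\<forall>\<^sub>F n in sequentially. \<forall>j\<in>J n. norm (q n j) \<le> 1 / 2"
    and abs: "\<forall>\<^sub>F n in sequentially. (\<Sum>j\<in>J n. norm (q n j)) \<le> K * (s n)\<^sup>2"
    and gap: "\<forall>\<^sub>F n in sequentially. (s n)\<^sup>2 \<le> L * (m n - (\<Sum>j\<in>J n. norm (q n j) ^ 2))"
  shows "(\<lambda>n. SUP k::int. \<bar>measure_pmf.prob (M n) {a. int (X a) = k}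
            - 1 / (sqrt (2 * pi) * s n) * exp (- (real_of_int k - m n)\<^sup>2 / (2 * (s n)\<^sup>2))\<bar>)
         \<in> o[sequentially](\<lambda>n. 1 / s n)"
\<comment> \<open>The 18 comes from the lower bound on \<open>1 - cos t\<close>, the
  \<open>L\<close> from \<open>gap\<close>.\<close>
proof (rule local_limit_criterion[where c = "1 / (18 * L)"])
  show "filterlim s at_top sequentially" by (rule s)
  show "1 / (18 * L) > 0" using L by simp
  show "\<forall>\<^sub>F n in sequentially. finite (set_pmf (M n))"
    using fin by (rule eventually_mono) blast
  have char: "\<forall>\<^sub>F n in sequentially. \<forall>t::real. measure_pmf.expectation (M n) (\<lambda>a. iexp (t * real_of_int (int (X a)))) = 
      (\<Prod>j\<in>J n. 1 + q n j * (iexp t - 1))"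
    using pgf
  proof eventually_elim
    case (elim n)
    have "iexp (t * real_of_int (int k)) = iexp t ^ k" for t :: real and k
      by (simp add: exp_of_nat_mult[symmetric] mult_ac)
    then show ?case using elim by simp
  qed
  have mom: "\<forall>\<^sub>F n in sequentially. of_real (m n) = (\<Sum>j\<in>J n. q n j) \<and>
       of_real ((s n)\<^sup>2) = (\<Sum>j\<in>J n. q n j * (1 - q n j))"
    using fin pgf
  proof eventually_elim
    case (elim n)
    have "(s n)\<^sup>2 = measure_pmf.variance (M n) (\<lambda>a. real (X a))"
      unfolding sd by (intro real_sqrt_pow2 Bochner_Integration.integral_nonneg) simp
    then show ?case
      using moments_of_factored_pgf[of "M n" "J n" X "q n"] elim mean[of n] by simp
  qed
  show "\<forall>\<^sub>F n in sequentially. \<forall>t. \<bar>t\<bar> \<le> pi \<longrightarrow>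
       norm (measure_pmf.expectation (M n) (\<lambda>a. iexp (t * real_of_int (int (X a)))))
         \<le> exp (- (1 / (18 * L)) * (s n)\<^sup>2 * t\<^sup>2)"
    using char mom gap
  proof eventually_elim
    case (elim n)
    show ?case
    proof (intro allI impI)
      fix t :: real assume t: "\<bar>t\<bar> \<le> pi"
      define Q where "Q = m n - (\<Sum>j\<in>J n. norm (q n j) ^ 2)"
      have sQ: "(s n)\<^sup>2 / L \<le> Q" using elim(3) L by (simp add: Q_def field_simps)
      have "norm (measure_pmf.expectation (M n) (\<lambda>a. iexp (t * real_of_int (int (X a)))))
         \<le> exp (- (1 - cos t) * Q)"
        using elim(1) norm_prod_bernoulli_char_le[of "q n" "J n" "m n" t] elim(2) by (simp add: Q_def)
      also have "\<dots> \<le> exp (- (t\<^sup>2 / 18 * ((s n)\<^sup>2 / L)))"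
      proof -
        have "t\<^sup>2 / 18 * ((s n)\<^sup>2 / L) \<le> (1 - cos t) * Q"
          using one_minus_cos_ge[OF t] sQ L by (intro mult_mono) auto
        then have "- ((1 - cos t) * Q) \<le> - (t\<^sup>2 / 18 * ((s n)\<^sup>2 / L))"
          by (rule le_imp_neg_le)
        then show ?thesis
          unfolding exp_le_cancel_iff mult_minus_left .
      qed
      finally show "norm (measure_pmf.expectation (M n) (\<lambda>a. iexp (t * real_of_int (int (X a)))))
         \<le> exp (- (1 / (18 * L)) * (s n)\<^sup>2 * t\<^sup>2)" by (simp add: field_simps)
    qed
  qed
  show "(\<lambda>n. measure_pmf.expectation (M n) (\<lambda>a. iexp (x / s n * real_of_int (int (X a))))
        * iexp (- (x / s n * m n))) \<longlonglongrightarrow> of_real (exp (- x\<^sup>2 / 2))" for x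
  proof -
    \<comment> \<open>The cumulant remainder of one factor at \<open>t = x / s n\<close>. In the sum
      \<open>R\<close> the first-order terms cancel against the centring, because the
      \<open>q n j\<close> sum to \<open>m n\<close>, and the second-order terms give exactly
      \<open>x\<^sup>2 / 2\<close>, because the variance is \<open>(s n)\<^sup>2\<close>.\<close>
    define r where "r = (\<lambda>n j. Ln (1 + q n j * (iexp (x / s n) - 1)) - \<i> * (x / s n) * q n j
        + q n j * (1 - q n j) * (x / s n)\<^sup>2 / 2)"
    define R where "R = (\<lambda>n. \<Sum>j\<in>J n. r n j)"
    \<comment> \<open>This makes \<open>s n\<close> positive and
      \<open>\<bar>x / s n\<bar> \<le> 1\<close>, the range of the cumulant estimate.\<close>
    have large: "\<forall>\<^sub>F n in sequentially. s n \<ge> \<bar>x\<bar> + 1"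
      using s by (rule eventually_compose_filterlim[OF eventually_ge_at_top])
    have eq: "\<forall>\<^sub>F n in sequentially. exp (R n - of_real (x\<^sup>2 / 2)) = 
      measure_pmf.expectation (M n) (\<lambda>a. iexp (x / s n * real_of_int (int (X a))))
        * iexp (- (x / s n * m n))"
      using char mom half fin large
    proof eventually_elim
      case (elim n)
      have sn: "s n > 0" and xs: "\<bar>x / s n\<bar> \<le> 1" using elim(5) by (auto simp: field_simps)
      have nz: "1 + q n j * (iexp (x / s n) - 1) \<noteq> 0" if "j \<in> J n" for j
        using norm_Ln_bernoulli_cumulant_le(1)[OF _ xs] elim(3) that by blast
      have "R n = (\<Sum>j\<in>J n. Ln (1 + q n j * (iexp (x / s n) - 1))) - \<i> * (x / s n) * (\<Sum>j\<in>J n. q n j)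
          + (\<Sum>j\<in>J n. q n j * (1 - q n j)) * (x / s n)\<^sup>2 / 2"
        by (simp add: R_def r_def sum.distrib sum_subtractf sum_distrib_left sum_distrib_right sum_divide_distrib)
      also have "(\<Sum>j\<in>J n. q n j) = of_real (m n)" using elim(2) by simp
      also have "(\<Sum>j\<in>J n. q n j * (1 - q n j)) = of_real ((s n)\<^sup>2)" using elim(2) by simp
      finally have "R n - of_real (x\<^sup>2 / 2) = (\<Sum>j\<in>J n. Ln (1 + q n j * (iexp (x / s n) - 1))) + \<i> * of_real (- (x / s n * m n))"
        using sn by (simp add: power_divide field_simps)
      then have "exp (R n - of_real (x\<^sup>2 / 2)) =
          exp (\<Sum>j\<in>J n. Ln (1 + q n j * (iexp (x / s n) - 1))) * iexp (- (x / s n * m n))"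
        by (simp only: exp_add)
      also have "exp (\<Sum>j\<in>J n. Ln (1 + q n j * (iexp (x / s n) - 1)))
          = (\<Prod>j\<in>J n. 1 + q n j * (iexp (x / s n) - 1))"
        unfolding exp_sum[OF conjunct2[OF elim(4)]] by (intro prod.cong refl exp_Ln nz)
      also have "\<dots> = measure_pmf.expectation (M n) (\<lambda>a. iexp (x / s n * real_of_int (int (X a))))"
        by (rule elim(1)[rule_format, symmetric])
      finally show ?case .
    qed
    have bnd: "\<forall>\<^sub>F n in sequentially. norm (R n) \<le> (3 * K * \<bar>x\<bar> ^ 3) * (1 / s n)"
      using half abs large
    proof eventually_elim
      case (elim n)
      have sn: "s n > 0" and xs: "\<bar>x / s n\<bar> \<le> 1" using elim(3) by (auto simp: field_simps)
      have "norm (R n) \<le> (\<Sum>j\<in>J n. 3 * norm (q n j) * \<bar>x / s n\<bar> ^ 3)"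
        unfolding R_def r_def using elim(1) norm_Ln_bernoulli_cumulant_le(2)[OF _ xs]
        by (intro sum_norm_le) auto
      also have "\<dots> = 3 * (\<Sum>j\<in>J n. norm (q n j)) * \<bar>x / s n\<bar> ^ 3"
        by (simp add: sum_distrib_left sum_distrib_right)
      also have "\<dots> \<le> 3 * (K * (s n)\<^sup>2) * \<bar>x / s n\<bar> ^ 3"
        using elim(2) by (intro mult_right_mono mult_left_mono) auto
      also have "\<dots> = (3 * K * \<bar>x\<bar> ^ 3) * (1 / s n)"
        using sn by (simp add: abs_divide power_divide power3_eq_cube power2_eq_square)
      finally show ?case .
    qed
    have "(\<lambda>n. 1 / s n) \<longlonglongrightarrow> 0"
      using s by (intro tendsto_divide_0[OF tendsto_const] filterlim_at_top_imp_at_infinity)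
    then have "(\<lambda>n. (3 * K * \<bar>x\<bar> ^ 3) * (1 / s n)) \<longlonglongrightarrow> 0"
      by (rule tendsto_mult_right_zero)
    then have "R \<longlonglongrightarrow> 0" by (rule Lim_null_comparison[OF bnd])
    then have "(\<lambda>n. exp (R n - of_real (x\<^sup>2 / 2))) \<longlonglongrightarrow> exp (0 - of_real (x\<^sup>2 / 2))"
      by (intro tendsto_exp tendsto_diff tendsto_const)
    then have "(\<lambda>n. exp (R n - of_real (x\<^sup>2 / 2))) \<longlonglongrightarrow> of_real (exp (- x\<^sup>2 / 2))"
      by (simp add: exp_of_real[symmetric])
    then show ?thesis by (rule Lim_transform_eventually[OF _ eq])
  qed
qed

section \<open>Factorization of complex polynomials with constant term 1\<close>

text \<open>Since 0 is not a root, each factor with root \<open>r\<close> is \<open>- r\<close>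
  times \<open>[:1, - inverse r:]\<close>. The scalars and the leading coefficient multiply to the
  value at 0, which is 1.\<close>

lemma poly_factorization_inverse_roots:
  fixes p :: "complex poly"
  assumes "poly p 0 = 1"
  obtains a where "p = (\<Prod>j<degree p. [:1, a j:])" and "\<And>j. j < degree p \<Longrightarrow> a j \<noteq> 0"
proof -
  have p0: "p \<noteq> 0" using assms by auto
  obtain A where A: "size A = degree p" "p = smult (lead_coeff p) (\<Prod>x\<in>#A. [:- x, 1:])"
    using alg_closed_imp_factorization[OF p0] by blast
  obtain xs where xs: "mset xs = A" using ex_mset by blast
  have len: "length xs = degree p" using A(1) xs by (metis size_mset)
  define c where "c = lead_coeff p"
  have p: "p = smult c (\<Prod>j<degree p. [:- (xs ! j), 1:])"
  proof -
    have "(\<Prod>x\<in>#A. [:- x, 1:]) = prod_list (map (\<lambda>x. [:- x, 1:]) xs)"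
      unfolding xs[symmetric] mset_map[symmetric] prod_mset_prod_list ..
    also have "\<dots> = (\<Prod>j<degree p. [:- (xs ! j), 1:])"
      by (simp add: prod.list_conv_set_nth len atLeast0LessThan)
    finally show ?thesis using A(2) unfolding c_def by simp
  qed
  have "poly p 0 = c * (\<Prod>j<degree p. - (xs ! j))"
    by (subst p) (simp add: poly_prod)
  then have c: "c * (\<Prod>j<degree p. - (xs ! j)) = 1" using assms by simp
  then have "(\<Prod>j<degree p. - (xs ! j)) \<noteq> 0" by (metis mult_zero_right zero_neq_one)
  then have nz: "xs ! j \<noteq> 0" if "j < degree p" for j using that by auto
  have "[:- (xs ! j), 1:] = smult (- (xs ! j)) [:1, - inverse (xs ! j):]" if "j < degree p" for j
    using nz[OF that] by simp
  then have "(\<Prod>j<degree p. [:- (xs ! j), 1:]) = (\<Prod>j<degree p. smult (- (xs ! j)) [:1, - inverse (xs ! j):])"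
    by (intro prod.cong) auto
  also have "\<dots> = smult (\<Prod>j<degree p. - (xs ! j)) (\<Prod>j<degree p. [:1, - inverse (xs ! j):])"
    by (rule prod_smult)
  finally have "p = smult (c * (\<Prod>j<degree p. - (xs ! j))) (\<Prod>j<degree p. [:1, - inverse (xs ! j):])"
    using p by simp
  then have "p = (\<Prod>j<degree p. [:1, - inverse (xs ! j):])" using c by simp
  then show ?thesis by (rule that) (simp add: nz)
qed

section \<open>Zeros of the independence polynomial\<close>

text \<open>The vertex set \<open>S\<close> is a parameter, so that vertices can be deleted without
  changing \<open>G\<close>; the coefficients are complex because the zeros matter.\<close>

definition indep_poly :: "'a pair_pre_digraph \<Rightarrow> 'a set \<Rightarrow> complex poly" where
  "indep_poly G S = (\<Sum>I | independent_set G I \<and> I \<subseteq> S. monom 1 (card I))"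

lemma poly_indep_poly:
  "poly (indep_poly G S) z = (\<Sum>I | independent_set G I \<and> I \<subseteq> S. z ^ card I)"
  by (simp add: indep_poly_def poly_sum poly_monom)

lemma indep_poly_empty [simp]: "indep_poly G {} = 1"
proof -
  have "{I. independent_set G I \<and> I \<subseteq> {}} = {{}}" by (auto simp: independent_set_def)
  then show ?thesis by (simp add: indep_poly_def)
qed

lemma finite_independent_subsets:
  "finite S \<Longrightarrow> finite {I. independent_set G I \<and> I \<subseteq> S}"
  by (rule finite_subset[of _ "Pow S"]) auto

lemma degree_indep_poly_le:
  assumes "finite S"
  shows "degree (indep_poly G S) \<le> card S"
  unfolding indep_poly_def
proof (intro degree_sum_le finite_independent_subsets assms)
  fix I assume "I \<in> {I. independent_set G I \<and> I \<subseteq> S}"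
  then show "degree (monom 1 (card I) :: complex poly) \<le> card S"
    using assms by (intro order_trans[OF degree_monom_le]) (auto intro: card_mono)
qed

context pair_graph
begin

lemma arc_commute: "(u, v) \<in> parcs G \<longleftrightarrow> (v, u) \<in> parcs G"
  using pair_sym_arcs by (auto simp: symmetric_def dest: symD)

lemma no_loop: "(v, v) \<notin> parcs G"
  using pair_no_loops[of "(v, v)"] by auto

lemma independent_set_insert_iff:
  assumes "v \<in> pverts G"
  shows "independent_set G (insert v I) \<longleftrightarrow> independent_set G I \<and> I \<inter> {u. (v, u) \<in> parcs G} = {}"
proof -
  have "(u, v) \<notin> parcs G \<longleftrightarrow> (v, u) \<notin> parcs G" for u using arc_commute by blast
  then show ?thesis using assms no_loop[of v] unfolding independent_set_def by blast
qed

text \<open>Independent subsets of \<open>S\<close> either avoid \<open>v\<close>, or arise by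
  inserting \<open>v\<close> into one that avoids \<open>v\<close> and all its neighbours, which
  contributes a factor \<open>z\<close>.\<close>

lemma poly_indep_poly_delete:
  assumes S: "S \<subseteq> pverts G" and v: "v \<in> S"
  shows "poly (indep_poly G S) z = poly (indep_poly G (S - {v})) z
    + z * poly (indep_poly G (S - {v} - {u. (v, u) \<in> parcs G})) z"
proof -
  let ?N = "{u. (v, u) \<in> parcs G}"
  have fin: "finite S" using S pair_finite_verts finite_subset by blast
  let ?A = "\<lambda>S. {I. independent_set G I \<and> I \<subseteq> S}"
  have split: "?A S = ?A (S - {v}) \<union> insert v ` ?A (S - {v} - ?N)"
  proof (intro equalityI subsetI)
    fix I assume I: "I \<in> ?A S"
    show "I \<in> ?A (S - {v}) \<union> insert v ` ?A (S - {v} - ?N)"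
    proof (cases "v \<in> I")
      case True
      then have "I = insert v (I - {v})" by auto
      moreover have "I - {v} \<in> ?A (S - {v} - ?N)"
      proof -
        have "independent_set G (I - {v})" "(I - {v}) \<inter> ?N = {}"
          using I independent_set_insert_iff[of v "I - {v}"] S v \<open>I = insert v (I - {v})\<close>
          by (metis (no_types, lifting) mem_Collect_eq subsetD)+
        then show ?thesis using I by blast
      qed
      ultimately show ?thesis by blast
    qed (use I in auto)
  next
    fix I assume "I \<in> ?A (S - {v}) \<union> insert v ` ?A (S - {v} - ?N)"
    then show "I \<in> ?A S"
      using independent_set_insert_iff[of v] S v by blast
  qed
  have inj: "inj_on (insert v) (?A (S - {v} - ?N))"
  proof (rule inj_onI)
    fix I I' assume "I \<in> ?A (S - {v} - ?N)" "I' \<in> ?A (S - {v} - ?N)" "insert v I = insert v I'"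
    then show "I = I'" using insert_ident[of v I I'] by blast
  qed
  have "poly (indep_poly G S) z = (\<Sum>I\<in>?A (S - {v}). z ^ card I)
     + (\<Sum>I\<in>insert v ` ?A (S - {v} - ?N). z ^ card I)"
    unfolding poly_indep_poly split
    by (intro sum.union_disjoint finite_imageI finite_independent_subsets) (use fin in auto)
  also have "(\<Sum>I\<in>insert v ` ?A (S - {v} - ?N). z ^ card I) = (\<Sum>I\<in>?A (S - {v} - ?N). z * z ^ card I)"
    unfolding sum.reindex[OF inj] comp_def
  proof (rule sum.cong[OF refl])
    fix I assume "I \<in> ?A (S - {v} - ?N)"
    then have "finite I" "v \<notin> I" using fin finite_subset by auto
    then show "z ^ card (insert v I) = z * z ^ card I" by simp
  qed
  finally show ?thesis by (simp add: poly_indep_poly sum_distrib_left)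
qed

lemma card_neighbours: "card {u. (v, u) \<in> parcs G} = out_degree (with_proj G) v"
proof -
  have "bij_betw snd (out_arcs (with_proj G) v) {u. (v, u) \<in> parcs G}"
    by (rule bij_betwI[where g = "\<lambda>u. (v, u)"]) (auto simp: out_arcs_def)
  from bij_betw_same_card[OF this] show ?thesis by (simp add: out_degree_def)
qed

lemma finite_neighbours: "finite {u. (v, u) \<in> parcs G}"
  by (rule finite_subset[OF _ pair_finite_verts]) (auto dest: in_arcsD2)

text \<open>Deleting a vertex \<open>v\<close> costs at most a factor \<open>1 - 1 / (2\<Delta>)\<close>: by induction the at most \<open>\<Delta>\<close>
  neighbours of \<open>v\<close> can be deleted from \<open>S - {v}\<close> at the cost of a factor
  \<open>(1 - 1 / (2\<Delta>)) ^ \<Delta> \<ge> 1 / 2\<close>.\<close>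

lemma norm_indep_poly_ge:
  fixes \<Delta> :: nat and z :: complex
  assumes \<Delta>: "\<Delta> \<ge> 1" and deg: "\<And>v. v \<in> pverts G \<Longrightarrow> out_degree (with_proj G) v \<le> \<Delta>"
    and z: "norm z \<le> 1 / (4 * real \<Delta>)"
    and S: "S \<subseteq> pverts G" and v: "v \<in> S"
  shows "norm (poly (indep_poly G S) z)
    \<ge> (1 - 1 / (2 * real \<Delta>)) * norm (poly (indep_poly G (S - {v})) z)"
  using S v
proof (induction "card S" arbitrary: S v rule: less_induct)
  case (less S v)
  let ?Z = "\<lambda>S. norm (poly (indep_poly G S) z)" and ?c = "1 - 1 / (2 * real \<Delta>)"
  have fin: "finite S" using less.prems pair_finite_verts finite_subset by blast
  have c0: "0 \<le> ?c" using \<Delta> by (simp add: field_simps)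
  \<comment> \<open>The vertices of \<open>N\<close> are removed one at a time. Every
    \<open>T - N\<close> has fewer vertices than \<open>S\<close>, so the induction hypothesis
    applies; a vertex outside \<open>T - N\<close> changes nothing, and
    \<open>?c \<le> 1\<close>.\<close>
  have del: "?c ^ card N * ?Z (T - N) \<le> ?Z T"
    if "T \<subseteq> S - {v}" "finite N" for T N
    using that(2)
  proof induction
    case (insert u N)
    have step: "?c * ?Z (T - insert u N) \<le> ?Z (T - N)"
    proof (cases "u \<in> T - N")
      case True
      have "card (T - N) < card S"
        using that(1) less.prems(2) fin by (intro psubset_card_mono) auto
      moreover have "T - N \<subseteq> pverts G" using that(1) less.prems(1) by auto
      ultimately have "?c * ?Z (T - N - {u}) \<le> ?Z (T - N)"
        using less.hyps True by blast
      moreover have "T - N - {u} = T - insert u N" by auto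
      ultimately show ?thesis by simp
    next
      case False
      then have "T - insert u N = T - N" by auto
      moreover have "?c * ?Z (T - N) \<le> 1 * ?Z (T - N)" by (intro mult_right_mono) auto
      ultimately show ?thesis by simp
    qed
    have "?c ^ card (insert u N) * ?Z (T - insert u N) = ?c ^ card N * (?c * ?Z (T - insert u N))"
      using insert by simp
    also have "\<dots> \<le> ?c ^ card N * ?Z (T - N)" using step c0 by (intro mult_left_mono) auto
    finally show ?case using insert.IH by simp
  qed simp
  let ?N = "{u. (v, u) \<in> parcs G}"
  have "1 / 2 \<le> ?c ^ \<Delta>"
  proof -
    have "1 + real \<Delta> * (- (1 / (2 * real \<Delta>))) \<le> (1 + (- (1 / (2 * real \<Delta>)))) ^ \<Delta>"
      using \<Delta> by (intro Bernoulli_inequality) (simp add: field_simps)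
    then show ?thesis using \<Delta> by simp
  qed
  also have "?c ^ \<Delta> \<le> ?c ^ card ?N"
    using deg[of v] less.prems c0 by (intro power_decreasing) (auto simp: card_neighbours)
  finally have "1 / 2 * ?Z (S - {v} - ?N) \<le> ?c ^ card ?N * ?Z (S - {v} - ?N)"
    by (rule mult_right_mono) simp
  also have "\<dots> \<le> ?Z (S - {v})" by (rule del[OF order_refl finite_neighbours])
  finally have half: "?Z (S - {v} - ?N) \<le> 2 * ?Z (S - {v})" by simp
  \<comment> \<open>By the bound on \<open>z\<close>, the second term of the deletion recurrence is
    at most the fraction \<open>1 / (2 * real \<Delta>)\<close> of the first.\<close>
  have "norm (z * poly (indep_poly G (S - {v} - ?N)) z) \<le> 1 / (4 * real \<Delta>) * (2 * ?Z (S - {v}))"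
    unfolding norm_mult by (intro mult_mono z half) auto
  then have "?Z (S - {v}) - 1 / (4 * real \<Delta>) * (2 * ?Z (S - {v})) \<le> ?Z S"
    unfolding poly_indep_poly_delete[OF less.prems]
    using norm_diff_ineq[of "poly (indep_poly G (S - {v})) z" "z * poly (indep_poly G (S - {v} - ?N)) z"]
    by linarith
  then show ?case by (simp add: algebra_simps)
qed

text \<open>Starting from the value 1 on the empty set, each added vertex multiplies the modulus by
  at least the positive number \<open>1 - 1 / (2 * real \<Delta>)\<close>.\<close>

lemma indep_poly_nonzero:
  fixes \<Delta> :: nat and z :: complex
  assumes \<Delta>: "\<Delta> \<ge> 1" and deg: "\<And>v. v \<in> pverts G \<Longrightarrow> out_degree (with_proj G) v \<le> \<Delta>"
    and z: "norm z \<le> 1 / (4 * real \<Delta>)"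
    and S: "S \<subseteq> pverts G"
  shows "poly (indep_poly G S) z \<noteq> 0"
proof -
  have "finite S" using S pair_finite_verts finite_subset by blast
  then show ?thesis using S
  proof induction
    case (insert v S)
    have "0 < 1 - 1 / (2 * real \<Delta>)" using \<Delta> by (simp add: field_simps)
    moreover have "insert v S - {v} = S" using insert.hyps by auto
    ultimately have "0 < (1 - 1 / (2 * real \<Delta>)) * norm (poly (indep_poly G (insert v S - {v})) z)"
      using insert by auto
    also have "\<dots> \<le> norm (poly (indep_poly G (insert v S)) z)"
      by (rule norm_indep_poly_ge[OF \<Delta> deg z insert.prems]) auto
    finally show ?case by auto
  qed simp
qed

lemma coeff_indep_poly_0: "coeff (indep_poly G (pverts G)) 0 = 1"
  and coeff_indep_poly_1: "coeff (indep_poly G (pverts G)) 1 = of_nat (card (pverts G))"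
proof -
  let ?A = "{I. independent_set G I \<and> I \<subseteq> pverts G}"
  have finA: "finite ?A" by (rule finite_independent_subsets[OF pair_finite_verts])
  have c: "coeff (indep_poly G (pverts G)) k = of_nat (card {I \<in> ?A. card I = k})" for k
    using finA by (simp add: indep_poly_def coeff_sum sum.If_cases Int_def)
  have "{I \<in> ?A. card I = 0} = {{}}"
  proof -
    have "card I = 0 \<longleftrightarrow> I = {}" if "I \<subseteq> pverts G" for I
      using finite_subset[OF that pair_finite_verts] by simp
    then show ?thesis by (auto simp: independent_set_def)
  qed
  then show "coeff (indep_poly G (pverts G)) 0 = 1" unfolding c by simp
  have "{I \<in> ?A. card I = 1} = (\<lambda>v. {v}) ` pverts G"
    using no_loop by (auto simp: independent_set_def card_1_singleton_iff)
  then show "coeff (indep_poly G (pverts G)) 1 = of_nat (card (pverts G))"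
    unfolding c by (simp add: card_image)
qed

text \<open>The roots are the numbers \<open>- inverse (a j)\<close>, so the zero-free disc turns
  into the bound on \<open>a j\<close>. The sum of the \<open>a j\<close> is the linear coefficient,
  which counts the one-vertex independent sets.\<close>

lemma indep_poly_factorization:
  fixes \<Delta> :: nat
  assumes \<Delta>: "\<Delta> \<ge> 1" and deg: "\<And>v. v \<in> pverts G \<Longrightarrow> out_degree (with_proj G) v \<le> \<Delta>"
  obtains a :: "nat \<Rightarrow> complex" and d where "d \<le> card (pverts G)"
    and "\<And>z. poly (indep_poly G (pverts G)) z = (\<Prod>j<d. 1 + a j * z)"
    and "\<And>j. j < d \<Longrightarrow> norm (a j) \<le> 4 * real \<Delta>"
    and "(\<Sum>j<d. a j) = of_nat (card (pverts G))"
proof -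
  let ?P = "indep_poly G (pverts G)"
  obtain a where P: "?P = (\<Prod>j<degree ?P. [:1, a j:])" and nz: "\<And>j. j < degree ?P \<Longrightarrow> a j \<noteq> 0"
    using poly_factorization_inverse_roots[of ?P] coeff_indep_poly_0 by (auto simp: poly_0_coeff_0)
  have ev: "poly ?P z = (\<Prod>j<degree ?P. 1 + a j * z)" for z
    by (subst P) (simp add: poly_prod mult_ac)
  show ?thesis
  proof (rule that)
    show "degree ?P \<le> card (pverts G)" by (rule degree_indep_poly_le[OF pair_finite_verts])
    show "poly ?P z = (\<Prod>j<degree ?P. 1 + a j * z)" for z by (rule ev)
    show "norm (a j) \<le> 4 * real \<Delta>" if j: "j < degree ?P" for j
    proof (rule ccontr)
      assume "\<not> norm (a j) \<le> 4 * real \<Delta>"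
      then have z: "norm (- inverse (a j)) \<le> 1 / (4 * real \<Delta>)"
        using \<Delta> by (simp add: norm_inverse inverse_eq_divide norm_divide frac_le)
      have "poly ?P (- inverse (a j)) \<noteq> 0"
        by (rule indep_poly_nonzero[OF \<Delta> _ z order_refl]) (rule deg)
      moreover have "poly ?P (- inverse (a j)) = 0"
        unfolding ev using j nz[OF j] by (auto intro!: bexI[of _ j])
      ultimately show False by simp
    qed
    show "(\<Sum>j<degree ?P. a j) = of_nat (card (pverts G))"
      using coeff_prod_linear(1)[of "{..<degree ?P}" a] P coeff_indep_poly_1 by simp
  qed
qed

end

section \<open>Support and generating function of the hard-core model\<close>

lemma set_pmf_hard_core:
  assumes "finite (pverts G)" and "l > 0"
  shows "set_pmf (hard_core G l) = {I. independent_set G I}"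
  using pmf_hard_core[OF assms] partition_function_pos[OF assms] assms(2)
  by (auto simp: set_pmf_iff split: if_splits)

lemma hard_core_pgf:
  assumes fin: "finite (pverts G)" and l: "l > 0"
  shows "measure_pmf.expectation (hard_core G l) (\<lambda>I. z ^ card I) =
    poly (indep_poly G (pverts G)) (l * z) / poly (indep_poly G (pverts G)) l"
proof -
  have A: "{I. independent_set G I \<and> I \<subseteq> pverts G} = {I. independent_set G I}"
    by (auto simp: independent_set_def)
  have Z: "poly (indep_poly G (pverts G)) l = of_real (partition_function G l)"
    by (simp add: poly_indep_poly partition_function_def A)
  have "measure_pmf.expectation (hard_core G l) (\<lambda>I. z ^ card I)
     = (\<Sum>I | independent_set G I. pmf (hard_core G l) I *\<^sub>R z ^ card I)"
    by (rule integral_measure_pmf[OF finite_independent_sets[OF fin]])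
       (auto simp: set_pmf_hard_core[OF assms])
  also have "\<dots> = (\<Sum>I | independent_set G I. (l * z) ^ card I / of_real (partition_function G l))"
    by (intro sum.cong refl)
       (simp add: pmf_hard_core[OF assms] scaleR_conv_of_real power_mult_distrib)
  finally show ?thesis
    unfolding Z by (simp add: poly_indep_poly A sum_divide_distrib)
qed

section \<open>The hard-core model at low fugacity\<close>

text \<open>With \<open>b = a * l\<close>, the normalised factor
  \<open>(1 + b * z) / (1 + b)\<close> equals \<open>1 + q * (z - 1)\<close> for
  \<open>q = b / (1 + b)\<close>. The bound on \<open>l\<close> makes the sum of the
  \<open>norm (q j) ^ 2\<close> at most \<open>N * l / 6\<close>, so \<open>m\<close> and
  \<open>v\<close> stay comparable to \<open>N * l\<close>.\<close>

lemma (in pair_graph) hard_core_factored_pgf: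
  fixes \<Delta> :: nat and l :: real
  defines "M \<equiv> hard_core G l" and "N \<equiv> real (card (pverts G))"
  defines "m \<equiv> measure_pmf.expectation M (\<lambda>I. real (card I))"
    and "v \<equiv> measure_pmf.variance M (\<lambda>I. real (card I))"
  assumes \<Delta>: "\<Delta> \<ge> 3" and deg: "\<And>v. v \<in> pverts G \<Longrightarrow> out_degree (with_proj G) v \<le> \<Delta>"
    and l0: "l > 0" and l: "l \<le> 1 / (100 * (real \<Delta>)\<^sup>2)"
  obtains q :: "nat \<Rightarrow> complex" and d where
    "\<And>z. measure_pmf.expectation M (\<lambda>I. z ^ card I) = (\<Prod>j<d. 1 + q j * (z - 1))"
    and "\<And>j. j < d \<Longrightarrow> norm (q j) \<le> 1 / 2"
    and "(\<Sum>j<d. norm (q j)) \<le> 10 * real \<Delta> * v"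
    and "v \<le> 2 * (m - (\<Sum>j<d. norm (q j) ^ 2))"
    and "N * l / 2 \<le> v"
proof -
  have \<Delta>1: "1 \<le> \<Delta>" using \<Delta> by simp
  obtain a d where d: "d \<le> card (pverts G)"
    and Z: "\<And>z. poly (indep_poly G (pverts G)) z = (\<Prod>j<d. 1 + a j * z)"
    and a: "\<And>j. j < d \<Longrightarrow> norm (a j) \<le> 4 * real \<Delta>"
    and sum_a: "(\<Sum>j<d. a j) = of_nat (card (pverts G))"
    by (rule indep_poly_factorization[OF \<Delta>1]) (erule deg, blast)
  define b where "b = (\<lambda>j. a j * of_real l)"
  define q where "q = (\<lambda>j. b j / (1 + b j))"
  \<comment> \<open>A common bound for the \<open>norm (b j)\<close>. Squaring it leaves only one
    power of \<open>l\<close>, because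
    \<open>l * (real \<Delta>)\<^sup>2 \<le> 1 / 100\<close>.\<close>
  define t where "t = 4 * real \<Delta> * l"
  have t0: "t \<ge> 0" using l0 by (simp add: t_def)
  have l\<Delta>: "l * (real \<Delta>)\<^sup>2 \<le> 1 / 100"
    using l \<Delta> by (simp add: field_simps)
  have t2: "t\<^sup>2 \<le> 4 / 25 * l"
    using mult_right_mono[OF l\<Delta>, of "16 * l"] l0 by (simp add: t_def power2_eq_square mult_ac)
  \<comment> \<open>Here \<open>\<Delta> \<ge> 3\<close> enters, through
    \<open>3 * t \<le> \<Delta> * t \<le> 1 / 25\<close>.\<close>
  have t75: "t \<le> 1 / 75"
  proof -
    have "t * 3 \<le> t * real \<Delta>" using t0 \<Delta> by (intro mult_left_mono) auto
    also have "\<dots> \<le> 1 / 25" using l\<Delta> by (simp add: t_def power2_eq_square mult_ac)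
    finally show ?thesis by simp
  qed
  have b: "norm (b j) \<le> t" if "j < d" for j
    using mult_right_mono[OF a[OF that], of l] l0 by (simp add: b_def t_def norm_mult)
  have b1: "norm (1 + b j) \<ge> 74 / 75" if "j < d" for j
    using norm_diff_ineq[of 1 "b j"] b[OF that] t75 by simp
  then have nz: "1 + b j \<noteq> 0" if "j < d" for j using that by force
  have q: "norm (q j) \<le> 75 / 74 * t" if "j < d" for j
  proof -
    have "norm (q j) \<le> t / (74 / 75)"
      unfolding q_def norm_divide using b[OF that] b1[OF that] t0 by (intro frac_le) auto
    then show ?thesis by simp
  qed
  \<comment> \<open>The degree \<open>d\<close> may be smaller than \<open>N\<close>, so passing
    from \<open>d\<close> to \<open>N\<close> summands uses \<open>c \<ge> 0\<close>.\<close>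
  have sum_le: "(\<Sum>j<d. f j) \<le> N * c" if "\<And>j. j < d \<Longrightarrow> f j \<le> c" "c \<ge> 0" for f c
  proof -
    have "(\<Sum>j<d. f j) \<le> real d * c" using sum_bounded_above[of "{..<d}" f c] that by simp
    also have "\<dots> \<le> N * c" using d that(2) by (intro mult_right_mono) (auto simp: N_def)
    finally show ?thesis .
  qed
  define Q where "Q = (\<Sum>j<d. norm (q j) ^ 2)"
  have Nl: "N * (4 / 25 * l) = 4 / 25 * (N * l)" "N * l \<ge> 0" using l0 by (auto simp: N_def)
  have Q: "Q \<le> N * l / 6"
  proof -
    have "norm (q j) ^ 2 \<le> (75 / 74)\<^sup>2 * (4 / 25 * l)" if "j < d" for j
    proof -
      have "norm (q j) ^ 2 \<le> (75 / 74 * t)\<^sup>2" using q[OF that] by (intro power_mono) auto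
      also have "\<dots> \<le> (75 / 74)\<^sup>2 * (4 / 25 * l)"
        unfolding power_mult_distrib by (intro mult_left_mono t2) auto
      finally show ?thesis .
    qed
    then have "Q \<le> N * ((75 / 74)\<^sup>2 * (4 / 25 * l))" unfolding Q_def using l0 by (intro sum_le) auto
    also have "\<dots> \<le> N * (l / 6)"
      using l0 by (intro mult_left_mono) (auto simp: N_def power2_eq_square)
    finally show ?thesis by simp
  qed
  have fin: "finite (set_pmf M)"
    unfolding M_def set_pmf_hard_core[OF pair_finite_verts l0] by (rule finite_independent_sets[OF pair_finite_verts])
  have pgf: "measure_pmf.expectation M (\<lambda>I. z ^ card I) = (\<Prod>j<d. 1 + q j * (z - 1))" for z
  proof -
    have "measure_pmf.expectation M (\<lambda>I. z ^ card I) = (\<Prod>j<d. (1 + a j * (l * z)) / (1 + b j))"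
      unfolding M_def hard_core_pgf[OF pair_finite_verts l0] Z by (simp add: prod_dividef b_def)
    also have "\<dots> = (\<Prod>j<d. 1 + q j * (z - 1))"
      using nz by (intro prod.cong refl) (simp add: q_def b_def field_simps)
    finally show ?thesis .
  qed
  note mom = moments_of_factored_pgf[OF fin finite_lessThan pgf]
  have mq: "of_real m = (\<Sum>j<d. q j)" using mom(1) by (simp add: m_def)
  have vq: "of_real v = of_real m - (\<Sum>j<d. (q j)\<^sup>2)"
    using mom(2) unfolding mq by (simp add: v_def right_diff_distrib sum_subtractf power2_eq_square)
  \<comment> \<open>The \<open>b j\<close> sum to exactly \<open>N * l\<close>, and
    \<open>q j\<close> differs from \<open>b j\<close> only by the quadratic term
    \<open>(b j)\<^sup>2 / (1 + b j)\<close>.\<close>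
  have mN: "\<bar>m - N * l\<bar> \<le> N * l / 6"
  proof -
    have "(\<Sum>j<d. b j) = of_real (N * l)"
      using sum_a by (simp add: b_def N_def sum_distrib_right[symmetric])
    moreover have "q j = b j - (b j)\<^sup>2 / (1 + b j)" if "j < d" for j
      using nz[OF that] by (simp add: q_def field_simps power2_eq_square)
    ultimately have "of_real (m - N * l) = - (\<Sum>j<d. (b j)\<^sup>2 / (1 + b j))"
      using mq by (simp add: sum_subtractf)
    then have "\<bar>m - N * l\<bar> = norm (\<Sum>j<d. (b j)\<^sup>2 / (1 + b j))"
      by (metis norm_minus_cancel norm_of_real)
    also have "\<dots> \<le> (\<Sum>j<d. norm ((b j)\<^sup>2 / (1 + b j)))" by (rule norm_sum)
    also have "\<dots> \<le> N * (4 / 25 * l / (74 / 75))"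
    proof (rule sum_le)
      fix j assume j: "j < d"
      have "norm (b j) ^ 2 \<le> t\<^sup>2" using b[OF j] by (intro power_mono) auto
      with t2 have "norm (b j) ^ 2 \<le> 4 / 25 * l" by linarith
      then show "norm ((b j)\<^sup>2 / (1 + b j)) \<le> 4 / 25 * l / (74 / 75)"
        unfolding norm_divide norm_power using b1[OF j] l0 by (intro frac_le) auto
    qed (use l0 in simp)
    also have "\<dots> \<le> N * (l / 6)" using l0 by (intro mult_left_mono) (auto simp: N_def)
    finally show ?thesis by simp
  qed
  have vm: "\<bar>v - m\<bar> \<le> Q"
  proof -
    have "of_real (v - m) = - (\<Sum>j<d. (q j)\<^sup>2)" using vq by simp
    then have "\<bar>v - m\<bar> = norm (\<Sum>j<d. (q j)\<^sup>2)" by (metis norm_minus_cancel norm_of_real)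
    also have "\<dots> \<le> Q" unfolding Q_def norm_power[symmetric] by (rule norm_sum)
    finally show ?thesis .
  qed
  note bounds = abs_le_D1[OF mN] abs_le_D2[OF mN] abs_le_D1[OF vm] abs_le_D2[OF vm] Q Nl(2)
  \<comment> \<open>The variance is at most \<open>m + Q\<close>, and
    \<open>3 * Q \<le> N * l / 2 \<le> m\<close>. For the next line, \<open>v\<close> differs from
    \<open>N * l\<close> by at most a third of it.\<close>
  have v2: "v \<le> 2 * (m - Q)" using bounds by argo
  have v1: "N * l / 2 \<le> v" using bounds by argo
  have "(\<Sum>j<d. norm (q j)) \<le> N * (5 * real \<Delta> * l)"
  proof (rule sum_le)
    show "norm (q j) \<le> 5 * real \<Delta> * l" if "j < d" for j
    proof -
      have "75 / 74 * t \<le> 5 / 4 * t" using t0 by (intro mult_right_mono) auto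
      also have "\<dots> = 5 * real \<Delta> * l" by (simp add: t_def)
      finally show ?thesis using q[OF that] by linarith
    qed
  qed (use l0 in simp)
  also have "\<dots> = 10 * real \<Delta> * (N * l / 2)" by simp
  also have "\<dots> \<le> 10 * real \<Delta> * v" by (intro mult_left_mono v1) auto
  finally have sq: "(\<Sum>j<d. norm (q j)) \<le> 10 * real \<Delta> * v" .
  show ?thesis
  proof (rule that)
    show "norm (q j) \<le> 1 / 2" if "j < d" for j
      using q[OF that] t75 by linarith
  qed (use pgf sq v2 v1 in \<open>auto simp: Q_def\<close>)
qed

theorem theorem6p4:
  fixes \<Delta> :: nat
    and G :: "nat \<Rightarrow> 'a pair_pre_digraph"
    and lam \<mu> \<sigma> :: "nat \<Rightarrow> real"
  assumes "\<Delta> \<ge> 3"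
    and "\<And>n. n \<ge> 1 \<Longrightarrow> pair_graph (G n)"
    and "\<And>n. n \<ge> 1 \<Longrightarrow> card (pverts (G n)) = n"
    and "\<And>n v. n \<ge> 1 \<Longrightarrow> v \<in> pverts (G n) \<Longrightarrow> out_degree (with_proj (G n)) v \<le> \<Delta>"
    and "\<And>n. n \<ge> 1 \<Longrightarrow> lam n > 0"
    and "\<And>n. n \<ge> 1 \<Longrightarrow> lam n \<le> 1 / (100 * (real \<Delta>)\<^sup>2)"
    and "filterlim (\<lambda>n. real n * lam n) at_top sequentially"
    and "\<And>n. \<mu> n = measure_pmf.expectation (hard_core (G n) (lam n)) (\<lambda>I. real (card I))"
    and "\<And>n. \<sigma> n = sqrt (measure_pmf.variance (hard_core (G n) (lam n)) (\<lambda>I. real (card I)))"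
  shows "(\<lambda>n. SUP k::int. \<bar>measure_pmf.prob (hard_core (G n) (lam n)) {I. int (card I) = k}
            - 1 / (sqrt (2 * pi) * \<sigma> n) * exp (- (real_of_int k - \<mu> n)\<^sup>2 / (2 * (\<sigma> n)\<^sup>2))\<bar>)
         \<in> o[sequentially](\<lambda>n. 1 / \<sigma> n)"
proof -
  note \<mu> = assms(8) and \<sigma> = assms(9)
  let ?M = "\<lambda>n. hard_core (G n) (lam n)"
  let ?v = "\<lambda>n. measure_pmf.variance (?M n) (\<lambda>I. real (card I))"
  have \<sigma>2: "(\<sigma> n)\<^sup>2 = ?v n" for n
    unfolding \<sigma> by (intro real_sqrt_pow2 Bochner_Integration.integral_nonneg) simp
  \<comment> \<open>Bundling the properties into one predicate lets \<open>q\<close> and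
    \<open>d\<close> be chosen for all \<open>n \<ge> 1\<close> at once.\<close>
  define P where "P n q d \<longleftrightarrow>
    (\<forall>z. measure_pmf.expectation (?M n) (\<lambda>I. z ^ card I) = (\<Prod>j<d. 1 + q j * (z - 1)))
    \<and> (\<forall>j<d. norm (q j) \<le> 1 / 2) \<and> (\<Sum>j<d. norm (q j)) \<le> 10 * real \<Delta> * (\<sigma> n)\<^sup>2
    \<and> (\<sigma> n)\<^sup>2 \<le> 2 * (\<mu> n - (\<Sum>j<d. norm (q j) ^ 2)) \<and> real n * lam n / 2 \<le> (\<sigma> n)\<^sup>2"
    for n and q :: "nat \<Rightarrow> complex" and d
  have "\<exists>q d. P n q d"
    if n: "n \<ge> 1" for n
  proof -
    interpret pair_graph "G n" by (rule assms(2)[OF n])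
    obtain q :: "nat \<Rightarrow> complex" and d where
      "\<And>z. measure_pmf.expectation (?M n) (\<lambda>I. z ^ card I) = (\<Prod>j<d. 1 + q j * (z - 1))"
      "\<And>j. j < d \<Longrightarrow> norm (q j) \<le> 1 / 2"
      "(\<Sum>j<d. norm (q j)) \<le> 10 * real \<Delta> * ?v n"
      "?v n \<le> 2 * (measure_pmf.expectation (?M n) (\<lambda>I. real (card I)) - (\<Sum>j<d. norm (q j) ^ 2))"
      "real (card (pverts (G n))) * lam n / 2 \<le> ?v n"
      using hard_core_factored_pgf[OF assms(1) assms(4)[OF n] assms(5)[OF n] assms(6)[OF n]] by blast
    then show ?thesis unfolding P_def \<sigma>2 \<mu> assms(3)[OF n] by blast
  qed
  then obtain q d where P: "\<And>n. n \<ge> 1 \<Longrightarrow> P n (q n) (d n)" by metis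
  note q = P[unfolded P_def, THEN conjunct1, rule_format]
    P[unfolded P_def, THEN conjunct2, THEN conjunct1, rule_format]
    P[unfolded P_def, THEN conjunct2, THEN conjunct2, THEN conjunct1]
    P[unfolded P_def, THEN conjunct2, THEN conjunct2, THEN conjunct2, THEN conjunct1]
    P[unfolded P_def, THEN conjunct2, THEN conjunct2, THEN conjunct2, THEN conjunct2]
  have ev: "\<forall>\<^sub>F n in sequentially. P n" if "\<And>n. n \<ge> 1 \<Longrightarrow> P n" for P
    using that unfolding eventually_sequentially by blast
  \<comment> \<open>The variance is at least \<open>n * lam n / 2\<close>, so the standard deviation
    tends to infinity.\<close>
  have "filterlim (\<lambda>n. sqrt (1 / 2 * (real n * lam n))) at_top sequentially"
    by (intro filterlim_compose[OF sqrt_at_top] filterlim_tendsto_pos_mult_at_top[OF tendsto_const] assms(7)) simp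
  moreover have "\<forall>\<^sub>F n in sequentially. sqrt (1 / 2 * (real n * lam n)) \<le> \<sigma> n"
  proof (rule ev)
    fix n :: nat assume "n \<ge> 1"
    then have "sqrt (1 / 2 * (real n * lam n)) \<le> sqrt ((\<sigma> n)\<^sup>2)"
      using q(5)[of n] by (intro real_sqrt_le_mono) simp
    also have "\<dots> = sqrt (?v n)" by (simp only: \<sigma>2)
    also have "\<dots> = \<sigma> n" by (simp only: \<sigma>)
    finally show "sqrt (1 / 2 * (real n * lam n)) \<le> \<sigma> n" .
  qed
  ultimately have s: "filterlim \<sigma> at_top sequentially"
    by (rule filterlim_at_top_mono)
  show ?thesis
  \<comment> \<open>Both constants come from the properties in \<open>P\<close> and do not depend on
    \<open>n\<close>, since \<open>\<Delta>\<close> is fixed.\<close>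
  proof (rule factored_pgf_local_limit[OF \<mu> \<sigma> s, where L = 2 and J = "\<lambda>n. {..<d n}" and q = q and K = "10 * real \<Delta>"])
    show "\<forall>\<^sub>F n in sequentially. finite (set_pmf (?M n)) \<and> finite {..<d n}"
    proof (rule ev)
      fix n :: nat assume n: "n \<ge> 1"
      interpret pair_graph "G n" by (rule assms(2)[OF n])
      show "finite (set_pmf (?M n)) \<and> finite {..<d n}"
        by (simp add: set_pmf_hard_core pair_finite_verts assms(5)[OF n] finite_independent_sets)
    qed
  qed (simp, (intro ev allI ballI; rule q; simp)+)
qed

end
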